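(* Let $R\neq 0$ be an effective ring. Then there exist a free $R[\mathbb Z\times\mathbb Z]$-module $M$ of finite rank and a fixed finite subset $F\subseteq M$ of non-zero elements such that the subset sum problem for $F$ is undecidable: there is no algorithm that, given $m\in M$, decides whether there exist pairwise distinct $g_1,\dots,g_n\in\mathbb Z\times\mathbb Z$ and (not necessarily distinct) $f_1,\dots,f_n\in F$ with $m=\sum_{i=1}^n g_if_i$.
   Context: An effective ring is a unital ring whose elements and arithmetic can be represented effectively (e.g. $\mathbb Z$ or $\mathbb Z/n\mathbb Z$). Elements of a free $R[\mathbb Z\times\mathbb Z]$-module of finite rank on a basis $X$ are identified with finitely supported functions $(\mathbb Z\times\mathbb Z)\times X\to R$, with action $(g_0f)(g,x)=f(g_0^{-1}g,x)$, and are given to the algorithm in this finite form. *)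

theory Defs
  imports Main "HOL-Library.Nat_Bijection"
begin

datatype recf = Zero | Succ | Proj nat | Comp recf "recf list" | Prim recf recf | Mini recf

inductive eval :: "recf \<Rightarrow> nat list \<Rightarrow> nat \<Rightarrow> bool" where
  eval_zero: "eval Zero xs 0"
| eval_succ: "eval Succ (x # xs) (Suc x)"
| eval_proj: "i < length xs \<Longrightarrow> eval (Proj i) xs (xs ! i)"
| eval_comp: "list_all2 (\<lambda>g y. eval g xs y) gs ys \<Longrightarrow> eval f ys z \<Longrightarrow> eval (Comp f gs) xs z"
| eval_prim0: "eval g xs y \<Longrightarrow> eval (Prim g h) (0 # xs) y"
| eval_primS: "eval (Prim g h) (n # xs) y \<Longrightarrow> eval h (n # y # xs) z
      \<Longrightarrow> eval (Prim g h) (Suc n # xs) z"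
| eval_mini: "eval f (n # xs) 0 \<Longrightarrow> (\<forall>m<n. \<exists>k. eval f (m # xs) (Suc k))
      \<Longrightarrow> eval (Mini f) xs n"

definition computable1 :: "(nat \<Rightarrow> nat) \<Rightarrow> bool" where
  "computable1 f \<longleftrightarrow> (\<exists>c. \<forall>x. eval c [x] (f x))"

definition computable2 :: "(nat \<Rightarrow> nat \<Rightarrow> nat) \<Rightarrow> bool" where
  "computable2 f \<longleftrightarrow> (\<exists>c. \<forall>x y. eval c [x, y] (f x y))"

definition decidable_set :: "nat set \<Rightarrow> bool" where
  "decidable_set A \<longleftrightarrow> (\<exists>c. \<forall>x. eval c [x] (if x \<in> A then 1 else 0))"

text \<open>An effective presentation of a unital ring: an injective coding of its
  elements by natural numbers with decidable image, under which the ring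
  operations are computable (constants 0, 1 have fixed codes; equality is
  equality of codes).\<close>

definition effective_ring :: "('r::ring_1 \<Rightarrow> nat) \<Rightarrow> bool" where
  "effective_ring enc \<longleftrightarrow>
     inj enc \<and> decidable_set (range enc) \<and>
     (\<exists>a. computable2 a \<and> (\<forall>x y. a (enc x) (enc y) = enc (x + y))) \<and>
     (\<exists>m. computable2 m \<and> (\<forall>x y. m (enc x) (enc y) = enc (x * y))) \<and>
     (\<exists>n. computable1 n \<and> (\<forall>x. n (enc x) = enc (- x)))"

text \<open>The free module of rank k on basis {0..<k}: finitely supported functions
  (Z x Z) x {0..<k} \<rightarrow> R, represented as functions on (int x int) x nat vanishing
  for basis index \<ge> k.\<close>

definition free_mod :: "nat \<Rightarrow> ((int \<times> int) \<times> nat \<Rightarrow> 'r::zero) set" where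
  "free_mod k = {m. finite {p. m p \<noteq> 0} \<and> (\<forall>g x. k \<le> x \<longrightarrow> m (g, x) = 0)}"

definition shift :: "int \<times> int \<Rightarrow> ((int \<times> int) \<times> nat \<Rightarrow> 'r) \<Rightarrow> ((int \<times> int) \<times> nat \<Rightarrow> 'r)" where
  "shift g0 f = (\<lambda>((a, b), x). f ((a - fst g0, b - snd g0), x))"

definition subset_sum_set :: "((int \<times> int) \<times> nat \<Rightarrow> 'r::comm_monoid_add) set
      \<Rightarrow> ((int \<times> int) \<times> nat \<Rightarrow> 'r) set" where
  "subset_sum_set F = {m. \<exists>gs fs. length gs = length fs \<and> distinct gs \<and> set fs \<subseteq> F \<and>
       m = (\<lambda>p. \<Sum>i<length gs. shift (gs ! i) (fs ! i) p)}"

definition entry_code :: "('r \<Rightarrow> nat) \<Rightarrow> (int \<times> int) \<times> nat \<times> 'r \<Rightarrow> nat" where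
  "entry_code enc e = (case e of ((a, b), x, r) \<Rightarrow>
      prod_encode (int_encode a, prod_encode (int_encode b, prod_encode (x, enc r))))"

definition represents :: "('r::zero \<Rightarrow> nat) \<Rightarrow> nat \<Rightarrow> ((int \<times> int) \<times> nat \<Rightarrow> 'r) \<Rightarrow> bool" where
  "represents enc c m \<longleftrightarrow>
     (\<exists>es. c = list_encode (map (entry_code enc) es) \<and>
        distinct (map (\<lambda>(g, x, r). (g, x)) es) \<and>
        (\<forall>p. m p = (case map_of (map (\<lambda>(g, x, r). ((g, x), r)) es) p of
                        None \<Rightarrow> 0 | Some r \<Rightarrow> r)))"

definition decidable_in_mod :: "('r::zero \<Rightarrow> nat) \<Rightarrow> nat
      \<Rightarrow> ((int \<times> int) \<times> nat \<Rightarrow> 'r) set \<Rightarrow> bool" where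
  "decidable_in_mod enc k S \<longleftrightarrow>
     (\<exists>c. \<forall>code m. m \<in> free_mod k \<longrightarrow> represents enc code m \<longrightarrow>
          eval c [code] (if m \<in> S then 1 else 0))"

end

theory Submission
  imports Defs "HOL-Library.Countable" "HOL-Computational_Algebra.Primes"
begin

text \<open>
  Think of a module element as a square tile with labelled edges: placed at \<open>g\<close>, it adds its
  east and north labels at \<open>g\<close>, and subtracts its west labels at the west neighbour and its south
  labels at the south neighbour of \<open>g\<close>. Each label at each position gets at most one positive and
  one negative contribution, so over any ring with \<open>0 \<noteq> 1\<close> a sum has the prescribed value
  iff the labels of adjacent tiles match and finitely many special marks sit at the prescribed places.
  The tiles are chosen such that a finite tiling is the space-time diagram of an accepting run of one
  fixed register machine, with the registers in unary, and the distance of the two marks is the input.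

  The machine computes a universal function. If subset sums were decidable, the map from \<open>n\<close> to
  the answer for input \<open>n\<close> would be computed by a program; on the code of that program the
  machine accepts iff it does not. Since this only ever involves runs of total programs, it
  suffices to simulate computations that terminate.
\<close>

section \<open>Computable functions\<close>

text \<open>\<open>F\<close> is chosen before the input is known, so the machine has to be
  universal, and the input can enter only through the target element, which fixes nothing but the
  places of two marks. Width and height of the diagram are left to the tiling: \<open>after\<close>
  tiles and rows of steps may be repeated until there is room for the run, and finite support forces
  the initial row to end. Without any mark the blank tiling would always be a solution; the
  \<open>Origin\<close> mark enforces the corner tile, and from there the run is forced. Rejection
  is not divergence but arrival at an address outside the program that no tile accepts on its south
  edge. A tiling drives the run upwards row by row, so reaching that address excludes every tiling,
  whereas reaching \<open>acc\<close> yields one. Each half of the diagonal argument thus rests on a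
  single finite run.\<close>

definition computable :: "nat \<Rightarrow> (nat list \<Rightarrow> nat) \<Rightarrow> bool" where
  "computable k f \<longleftrightarrow> (\<exists>c. \<forall>xs. length xs = k \<longrightarrow> eval c xs (f xs))"

lemma computable_cong:
  "computable k f \<Longrightarrow> (\<And>xs. length xs = k \<Longrightarrow> f xs = g xs) \<Longrightarrow> computable k g"
  unfolding computable_def by metis

lemma computable_nth: "i < k \<Longrightarrow> computable k (\<lambda>xs. xs ! i)"
  unfolding computable_def by (metis eval_proj)

lemma computable_compose:
  assumes f: "computable (length gs) f" and gs: "\<And>g. g \<in> set gs \<Longrightarrow> computable k g"
  shows "computable k (\<lambda>xs. f (map (\<lambda>g. g xs) gs))"
proof -
  obtain c where c: "\<And>xs. length xs = length gs \<Longrightarrow> eval c xs (f xs)"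
    using f unfolding computable_def by auto
  obtain d where d: "\<And>g xs. g \<in> set gs \<Longrightarrow> length xs = k \<Longrightarrow> eval (d g) xs (g xs)"
    using gs unfolding computable_def by metis
  have "eval (Comp c (map d gs)) xs (f (map (\<lambda>g. g xs) gs))" if "length xs = k" for xs
    by (rule eval_comp[OF _ c]) (auto simp: list_all2_conv_all_nth d that)
  then show ?thesis unfolding computable_def by blast
qed

lemma computable_Suc: "computable k f \<Longrightarrow> computable k (\<lambda>xs. Suc (f xs))"
proof -
  assume f: "computable k f"
  have "computable 1 (\<lambda>xs. Suc (hd xs))"
    unfolding computable_def
    by (rule exI[of _ Succ]) (auto simp: length_Suc_conv intro: eval.intros)
  from computable_compose[of "[f]" "\<lambda>xs. Suc (hd xs)" k] this f show ?thesis by simp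
qed

lemma computable_const: "computable k (\<lambda>_. n)"
proof (induction n)
  case 0
  show ?case unfolding computable_def by (blast intro: eval_zero)
qed (rule computable_Suc)

lemma computable_rec_nat:
  assumes "computable k g" "computable (Suc (Suc k)) h"
  shows "computable (Suc k) (\<lambda>xs. rec_nat (g (tl xs)) (\<lambda>n y. h (n # y # tl xs)) (hd xs))"
proof -
  obtain c where c: "\<And>xs. length xs = k \<Longrightarrow> eval c xs (g xs)"
    using assms unfolding computable_def by auto
  obtain d where d: "\<And>xs. length xs = Suc (Suc k) \<Longrightarrow> eval d xs (h xs)"
    using assms unfolding computable_def by auto
  have "eval (Prim c d) (n # xs) (rec_nat (g xs) (\<lambda>n y. h (n # y # xs)) n)"
    if "length xs = k" for xs n
    by (induction n) (auto intro!: eval_prim0 eval_primS c d simp: that)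
  then have "eval (Prim c d) xs (rec_nat (g (tl xs)) (\<lambda>n y. h (n # y # tl xs)) (hd xs))"
    if "length xs = Suc k" for xs
    using that by (cases xs) auto
  then show ?thesis unfolding computable_def by blast
qed

lemma computable_Least:
  assumes "computable (Suc k) p" "\<And>xs. length xs = k \<Longrightarrow> \<exists>n. p (n # xs) = 0"
  shows "computable k (\<lambda>xs. LEAST n. p (n # xs) = 0)"
proof -
  obtain c where c: "\<And>xs. length xs = Suc k \<Longrightarrow> eval c xs (p xs)"
    using assms unfolding computable_def by auto
  have "eval (Mini c) xs (LEAST n. p (n # xs) = 0)" if l: "length xs = k" for xs
  proof (rule eval_mini)
    have "p ((LEAST n. p (n # xs) = 0) # xs) = 0"
      using assms(2)[OF l] by (auto intro: LeastI)
    then show "eval c ((LEAST n. p (n # xs) = 0) # xs) 0"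
      using c[of "(LEAST n. p (n # xs) = 0) # xs"] l by simp
    show "\<forall>m<LEAST n. p (n # xs) = 0. \<exists>j. eval c (m # xs) (Suc j)"
    proof (intro allI impI)
      fix m assume "m < (LEAST n. p (n # xs) = 0)"
      then have "p (m # xs) \<noteq> 0" using not_less_Least by blast
      then show "\<exists>j. eval c (m # xs) (Suc j)"
        using c[of "m # xs"] l by (metis length_Cons not0_implies_Suc)
    qed
  qed
  then show ?thesis unfolding computable_def by blast
qed

lemma computable_1I:
  assumes "computable 1 (\<lambda>xs. f (xs ! 0))" "computable k a"
  shows "computable k (\<lambda>xs. f (a xs))"
  using computable_compose[of "[a]" "\<lambda>xs. f (xs ! 0)" k] assms by simp

lemma computable_2I:
  assumes "computable 2 (\<lambda>xs. f (xs ! 0) (xs ! 1))" "computable k a" "computable k b"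
  shows "computable k (\<lambda>xs. f (a xs) (b xs))"
  using computable_compose[of "[a, b]" "\<lambda>xs. f (xs ! 0) (xs ! 1)" k] assms
  by (auto simp: numeral_2_eq_2)

lemma computable_1E:
  assumes "computable 1 f"
  obtains c where "\<And>x. eval c [x] (f [x])"
proof -
  obtain c where c: "\<And>xs. length xs = 1 \<Longrightarrow> eval c xs (f xs)"
    using assms unfolding computable_def by auto
  have "eval c [x] (f [x])" for x
    by (rule c) simp
  then show ?thesis by (rule that)
qed

lemma computable_2E:
  assumes "computable 2 f"
  obtains c where "\<And>x y. eval c [x, y] (f [x, y])"
proof -
  obtain c where c: "\<And>xs. length xs = 2 \<Longrightarrow> eval c xs (f xs)"
    using assms unfolding computable_def by auto
  have "eval c [x, y] (f [x, y])" for x y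
    by (rule c) simp
  then show ?thesis by (rule that)
qed

text \<open>Form of recursion that fits nested terms: the number of rounds is an arbitrary function,
  and the step may use all parameters. The parameters appear as \<open>drop 2 ys\<close> because
  counter and accumulator are put in front of them.\<close>

lemma computable_rec_nat':
  assumes g: "computable k g" and n: "computable k n"
    and h: "computable (Suc (Suc k)) (\<lambda>ys. h (ys ! 0) (ys ! 1) (drop 2 ys))"
  shows "computable k (\<lambda>xs. rec_nat (g xs) (\<lambda>i y. h i y xs) (n xs))"
proof -
  have *: "computable (Suc k) (\<lambda>xs. rec_nat (g (tl xs)) (\<lambda>i y. h i y (tl xs)) (hd xs))"
    using computable_rec_nat[OF g h] by (simp add: numeral_2_eq_2)
  let ?gs = "n # map (\<lambda>i xs. xs ! i) [0..<k]"
  have "computable k (\<lambda>xs. (\<lambda>xs. rec_nat (g (tl xs)) (\<lambda>i y. h i y (tl xs)) (hd xs)) (map (\<lambda>g. g xs) ?gs))"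
    by (rule computable_compose) (use * n in \<open>auto intro: computable_nth\<close>)
  moreover have "map (\<lambda>g. g xs) (map (\<lambda>i xs. xs ! i) [0..<k]) = xs" if "length xs = k" for xs :: "nat list"
    using that by (auto intro: nth_equalityI)
  ultimately show ?thesis
    by (elim computable_cong) auto
qed

lemma computable_drop2_nth:
  "Suc (Suc i) < k \<Longrightarrow> computable k (\<lambda>xs. drop 2 xs ! i)"
  by (rule computable_cong[OF computable_nth[of "Suc (Suc i)"]]) (auto)

section \<open>Arithmetic with truncated subtraction\<close>

lemma computable_add:
  assumes "computable k a" "computable k b" shows "computable k (\<lambda>xs. a xs + b xs)"
proof -
  have "computable k (\<lambda>xs. rec_nat (b xs) (\<lambda>i y. Suc y) (a xs))"
    using assms by (intro computable_rec_nat' computable_Suc computable_nth) auto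
  moreover have "rec_nat y (\<lambda>i y. Suc y) x = x + y" for x y by (induction x) auto
  ultimately show ?thesis by simp
qed

lemma computable_mult:
  assumes "computable k a" "computable k b" shows "computable k (\<lambda>xs. a xs * b xs)"
proof -
  have "computable 2 (\<lambda>xs. rec_nat 0 (\<lambda>i y. xs ! 1 + y) (xs ! 0))"
    by (intro computable_rec_nat' computable_add computable_nth computable_drop2_nth computable_const) auto
  moreover have "rec_nat 0 (\<lambda>i y. z + y) x = x * z" for x z :: nat by (induction x) auto
  ultimately show ?thesis using assms computable_2I[of "(*)"] by simp
qed

lemma computable_pred:
  assumes "computable k a" shows "computable k (\<lambda>xs. a xs - 1)"
proof -
  have "computable k (\<lambda>xs. rec_nat 0 (\<lambda>i y. i) (a xs))"
    using assms by (intro computable_rec_nat' computable_nth computable_const) auto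
  moreover have "rec_nat 0 (\<lambda>i y. i) x = x - 1" for x :: nat by (cases x) auto
  ultimately show ?thesis by simp
qed

lemma computable_diff:
  assumes "computable k a" "computable k b" shows "computable k (\<lambda>xs. a xs - b xs)"
proof -
  have "computable k (\<lambda>xs. rec_nat (a xs) (\<lambda>i y. y - 1) (b xs))"
    using assms by (intro computable_rec_nat' computable_pred computable_nth) auto
  moreover have "rec_nat x (\<lambda>i y. y - 1) z = x - z" for x z :: nat by (induction z) auto
  ultimately show ?thesis by simp
qed

lemma computable_if0:
  assumes "computable k a" "computable k b" "computable k c"
  shows "computable k (\<lambda>xs. if a xs = 0 then b xs else c xs)"
proof -
  have "computable k (\<lambda>xs. (1 - a xs) * b xs + (1 - (1 - a xs)) * c xs)"
    using assms by (intro computable_add computable_mult computable_diff computable_const)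
  moreover have "(1 - a xs) * b xs + (1 - (1 - a xs)) * c xs = (if a xs = 0 then b xs else c xs)" for xs
    by auto
  ultimately show ?thesis by simp
qed

lemma computable_pow2:
  assumes "computable k a" shows "computable k (\<lambda>xs. 2 ^ a xs)"
proof -
  have "computable k (\<lambda>xs. rec_nat 1 (\<lambda>i y. y + y) (a xs))"
    using assms by (intro computable_rec_nat' computable_add computable_nth computable_const) auto
  moreover have "rec_nat 1 (\<lambda>i y. y + y) x = (2::nat) ^ x" for x :: nat by (induction x) auto
  ultimately show ?thesis by simp
qed

lemma computable_triangle:
  assumes "computable k a" shows "computable k (\<lambda>xs. triangle (a xs))"
proof -
  have "computable k (\<lambda>xs. rec_nat 0 (\<lambda>i y. y + Suc i) (a xs))"
    using assms by (intro computable_rec_nat' computable_add computable_Suc computable_nth computable_const) auto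
  moreover have "rec_nat 0 (\<lambda>i y. y + Suc i) x = triangle x" for x :: nat by (induction x) auto
  ultimately show ?thesis by simp
qed

section \<open>Pairing, list codes and division\<close>

lemma computable_prod_encode:
  assumes "computable k a" "computable k b" shows "computable k (\<lambda>xs. prod_encode (a xs, b xs))"
proof -
  have "computable k (\<lambda>xs. triangle (a xs + b xs) + a xs)"
    using assms by (intro computable_triangle computable_add)
  then show ?thesis by (simp add: prod_encode_def)
qed

lemma triangle_mono: "i \<le> j \<Longrightarrow> triangle i \<le> triangle j"
  by (induction j rule: dec_induct) auto

text \<open>The codes of the pairs with sum \<open>s\<close> fill the interval from
  \<open>triangle s\<close> up to, but excluding, \<open>triangle (Suc s)\<close>. The diagonal of a
  code \<open>z\<close> is therefore the least \<open>s\<close> with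
  \<open>z < triangle (Suc s)\<close>, and a search inverts the pairing.\<close>

lemma Least_triangle:
  "(LEAST s. Suc (prod_encode (i, j)) - triangle (Suc s) = 0) = i + j"
proof (rule Least_equality)
  show "Suc (prod_encode (i, j)) - triangle (Suc (i + j)) = 0"
    by (simp add: prod_encode_def)
next
  fix s assume s: "Suc (prod_encode (i, j)) - triangle (Suc s) = 0"
  show "i + j \<le> s"
  proof (rule ccontr)
    assume "\<not> i + j \<le> s"
    then have "triangle (Suc s) \<le> triangle (i + j)" by (intro triangle_mono) auto
    then show False using s by (simp add: prod_encode_def)
  qed
qed

lemma computable_diagonal:
  assumes "computable k a"
  shows "computable k (\<lambda>xs. fst (prod_decode (a xs)) + snd (prod_decode (a xs)))"
proof (rule computable_1I[OF _ assms])
  have "computable 1 (\<lambda>xs. LEAST s. Suc (xs ! 0) - triangle (Suc s) = 0)"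
  proof (rule computable_cong[OF computable_Least])
    show "computable (Suc 1) (\<lambda>xs. Suc (xs ! 1) - triangle (Suc (xs ! 0)))"
      by (intro computable_diff computable_triangle computable_Suc computable_nth) auto
    show "\<exists>n. Suc ((n # xs) ! 1) - triangle (Suc ((n # xs) ! 0)) = 0" for xs
      by (rule exI[of _ "xs ! 0"]) simp
  qed simp
  moreover have "(LEAST s. Suc z - triangle (Suc s) = 0) = fst (prod_decode z) + snd (prod_decode z)" for z
    using Least_triangle[of "fst (prod_decode z)" "snd (prod_decode z)"] by simp
  ultimately show "computable 1 (\<lambda>xs. fst (prod_decode (xs ! 0)) + snd (prod_decode (xs ! 0)))"
    by simp
qed

lemma computable_fst:
  assumes "computable k a" shows "computable k (\<lambda>xs. fst (prod_decode (a xs)))"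
proof -
  have "computable k (\<lambda>xs. a xs - triangle (fst (prod_decode (a xs)) + snd (prod_decode (a xs))))"
    using assms by (intro computable_diff computable_triangle computable_diagonal)
  moreover have "z - triangle (fst (prod_decode z) + snd (prod_decode z)) = fst (prod_decode z)" for z
    using prod_decode_inverse[of z] unfolding prod_encode_def
    by (auto simp: split_beta)
  ultimately show ?thesis by simp
qed

lemma computable_snd:
  assumes "computable k a" shows "computable k (\<lambda>xs. snd (prod_decode (a xs)))"
proof -
  have "computable k (\<lambda>xs. (fst (prod_decode (a xs)) + snd (prod_decode (a xs))) - fst (prod_decode (a xs)))"
    using assms by (intro computable_diff computable_fst computable_diagonal)
  then show ?thesis by simp
qed

text \<open>Past the end the value is 0, since the empty list has code 0 and 0 decodes to
  \<open>(0, 0)\<close>. In \<open>universal\<close> this 0 signals that the program counter has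
  left the program.\<close>

definition nth_code :: "nat \<Rightarrow> nat \<Rightarrow> nat" where
  "nth_code n i = fst (prod_decode (rec_nat n (\<lambda>_ y. snd (prod_decode (y - 1))) i - 1))"

lemma computable_nth_code:
  assumes "computable k a" "computable k b" shows "computable k (\<lambda>xs. nth_code (a xs) (b xs))"
  unfolding nth_code_def using assms
  by (intro computable_fst computable_pred computable_rec_nat' computable_snd computable_nth) auto

lemma prod_decode_0: "prod_decode 0 = (0, 0)"
proof -
  have "prod_encode (0, 0) = 0" by (simp add: prod_encode_def)
  then show ?thesis by (metis prod_encode_inverse)
qed

lemma nth_code_list_encode:
  "nth_code (list_encode xs) i = (if i < length xs then xs ! i else 0)"
proof -
  have "rec_nat (list_encode xs) (\<lambda>_ y. snd (prod_decode (y - 1))) i = list_encode (drop i xs)"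
  proof (induction i)
    case (Suc i)
    show ?case
    proof (cases "drop i xs")
      case Nil
      then show ?thesis using Suc by (simp add: prod_decode_0)
    next
      case (Cons y ys)
      then have "drop (Suc i) xs = ys" by (metis drop_Suc drop_tl list.sel(3))
      then show ?thesis using Suc Cons by simp
    qed
  qed simp
  then show ?thesis
    using hd_drop_conv_nth[of i xs]
    by (cases "drop i xs") (auto simp: nth_code_def prod_decode_0)
qed

text \<open>The quotient by \<open>Suc b\<close> rounded up, in the form of a search; the successor
  keeps the divisor positive, so the search ends. The quotient is exact precisely on multiples,
  which gives a divisibility test.\<close>

definition quot :: "nat \<Rightarrow> nat \<Rightarrow> nat" where
  "quot s b = (LEAST q. s - q * Suc b = 0)"

lemma computable_quot:
  assumes "computable k a" "computable k b" shows "computable k (\<lambda>xs. quot (a xs) (b xs))"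
proof (rule computable_2I[OF _ assms])
  show "computable 2 (\<lambda>xs. quot (xs ! 0) (xs ! 1))"
  proof (rule computable_cong[OF computable_Least])
    show "computable (Suc 2) (\<lambda>xs. xs ! 1 - xs ! 0 * Suc (xs ! 2))"
      by (intro computable_diff computable_mult computable_Suc computable_nth) auto
    show "\<exists>n. (n # xs) ! 1 - (n # xs) ! 0 * Suc ((n # xs) ! 2) = 0" for xs
      by (rule exI[of _ "xs ! 0"]) simp
  qed (simp add: quot_def numeral_2_eq_2)
qed

lemma quot_mult: "quot (q * Suc b) b = q"
  unfolding quot_def by (rule Least_equality) (auto simp del: mult_Suc_right)

lemma quot_dvd_iff: "quot s b * Suc b = s \<longleftrightarrow> Suc b dvd s"
  by (metis dvd_triv_right dvdE mult.commute quot_mult)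

section \<open>Compiling recursive functions to register machines\<close>

datatype instr = INC nat nat | DEC nat nat nat

fun instr_reg :: "instr \<Rightarrow> nat" where
  "instr_reg (INC r j) = r"
| "instr_reg (DEC r j k) = r"

fun exec :: "instr \<Rightarrow> (nat \<Rightarrow> nat) \<Rightarrow> nat \<times> (nat \<Rightarrow> nat)" where
  "exec (INC r j) v = (j, v(r := Suc (v r)))"
| "exec (DEC r j k) v = (if v r = 0 then (k, v) else (j, v(r := v r - 1)))"

definition step :: "instr list \<Rightarrow> nat \<times> (nat \<Rightarrow> nat) \<Rightarrow> nat \<times> (nat \<Rightarrow> nat) \<Rightarrow> bool" where
  "step P c c' \<longleftrightarrow> fst c < length P \<and> c' = exec (P ! fst c) (snd c)"

text \<open>A structured language between recursive functions and machines. \<open>Loop\<close>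
  decrements its register before each round, which is exactly what \<open>DEC\<close>
  offers.\<close>

datatype com = Skip | Inc nat | Seq com com | Loop nat com

inductive bigstep :: "com \<Rightarrow> (nat \<Rightarrow> nat) \<Rightarrow> (nat \<Rightarrow> nat) \<Rightarrow> bool" where
  Skip: "bigstep Skip v v"
| Inc: "bigstep (Inc r) v (v(r := Suc (v r)))"
| Seq: "bigstep a v v' \<Longrightarrow> bigstep b v' v'' \<Longrightarrow> bigstep (Seq a b) v v''"
| Loop0: "v r = 0 \<Longrightarrow> bigstep (Loop r a) v v"
| LoopS: "v r \<noteq> 0 \<Longrightarrow> bigstep a (v(r := v r - 1)) v' \<Longrightarrow> bigstep (Loop r a) v' v''
    \<Longrightarrow> bigstep (Loop r a) v v''"

text \<open>There is no unconditional jump, so a second copy of the loop test closes the body: it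
  re-enters the body or leaves to the address after the block.\<close>

fun code :: "com \<Rightarrow> nat \<Rightarrow> instr list" where
  "code Skip n = []"
| "code (Inc r) n = [INC r (Suc n)]"
| "code (Seq a b) n = code a n @ code b (n + length (code a n))"
| "code (Loop r a) n = (let is = code a (Suc n); i = DEC r (Suc n) (n + length is + 2)
     in i # is @ [i])"

text \<open>Jump targets are absolute, so \<open>xs\<close> and \<open>ys\<close> stay arbitrary:
  the induction hypothesis has to apply to a subcommand at whatever offset its context puts
  it.\<close>

lemma steps_code:
  "bigstep a v v' \<Longrightarrow> P = xs @ code a (length xs) @ ys \<Longrightarrow>
   (step P)\<^sup>*\<^sup>* (length xs, v) (length xs + length (code a (length xs)), v')"
proof (induction arbitrary: xs ys rule: bigstep.induct)
  case (Inc r v)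
  then have "step P (length xs, v) (Suc (length xs), v(r := Suc (v r)))" unfolding step_def by simp
  then have "(step P)\<^sup>*\<^sup>* (length xs, v) (length xs + length (code (Inc r) (length xs)), v(r := Suc (v r)))"
    by simp
  then show ?case .
next
  case (Seq a v v' b v'')
  let ?ca = "code a (length xs)"
  have "(step P)\<^sup>*\<^sup>* (length xs, v) (length xs + length ?ca, v')"
    using Seq.IH(1)[of xs "code b (length xs + length ?ca) @ ys"] Seq.prems by simp
  also have "(step P)\<^sup>*\<^sup>* (length xs + length ?ca, v')
      (length xs + length ?ca + length (code b (length xs + length ?ca)), v'')"
    using Seq.IH(2)[of "xs @ ?ca" ys] Seq.prems by simp
  finally show ?case by (simp add: add.assoc)
next
  case (Loop0 v r a)
  then show ?case by (auto intro!: r_into_rtranclp simp: step_def Let_def)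
next
  case (LoopS v r a v' v'')
  let ?n = "length xs" and ?ca = "code a (Suc (length xs))"
  let ?e = "?n + length ?ca + 2"
  let ?i = "DEC r (Suc ?n) ?e"
  have P: "P = xs @ ?i # ?ca @ ?i # ys" using LoopS.prems by (simp add: Let_def)
  then have head: "P ! ?n = ?i" "?n < length P" by auto
  have "P = (xs @ ?i # ?ca) @ ?i # ys" using P by simp
  then have tail: "P ! (Suc ?n + length ?ca) = ?i" "Suc ?n + length ?ca < length P"
    using nth_append_length[of "xs @ ?i # ?ca" ?i ys] by auto
  have exit: "(step P)\<^sup>*\<^sup>* (?n, v') (?e, v'')"
    using LoopS.IH(2)[of xs ys] LoopS.prems by (simp add: Let_def)
  have "step P (?n, v) (Suc ?n, v(r := v r - 1))"
    using head LoopS.hyps by (simp add: step_def)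
  also have "(step P)\<^sup>*\<^sup>* (Suc ?n, v(r := v r - 1)) (Suc ?n + length ?ca, v')"
  proof -
    have "P = (xs @ [?i]) @ code a (length (xs @ [?i])) @ (?i # ys)" using P by simp
    from LoopS.IH(1)[OF this] show ?thesis by (simp only: length_append_singleton)
  qed
  also have "(step P)\<^sup>*\<^sup>* (Suc ?n + length ?ca, v') (?e, v'')"
  proof -
    \<comment> \<open>the closing instruction is a copy of the opening one, so the rest of the run is the same from both\<close>
    obtain c where "step P (?n, v') c" "(step P)\<^sup>*\<^sup>* c (?e, v'')"
      using exit by (cases rule: converse_rtranclpE) auto
    moreover from this have "step P (Suc ?n + length ?ca, v') c"
      using head tail by (simp add: step_def)
    ultimately show ?thesis by (meson converse_rtranclp_into_rtranclp)
  qed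
  finally show ?case by (simp add: Let_def)
qed auto

section \<open>Clearing and copying registers\<close>

definition clear :: "nat \<Rightarrow> com" where
  "clear r = Loop r Skip"

lemma bigstep_clear: "bigstep (clear r) v (v(r := 0))"
proof -
  have "bigstep (clear r) v (v(r := 0))" if "v r = n" for n
    using that
  proof (induction n arbitrary: v)
    case 0
    then have "v(r := 0) = v" by auto
    then show ?case unfolding clear_def using Loop0[of v r] 0 by simp
  next
    case (Suc n)
    have "bigstep (clear r) (v(r := v r - 1)) (v(r := v r - 1, r := 0))"
      using Suc.prems by (intro Suc.IH) simp
    then have loop: "bigstep (Loop r Skip) (v(r := v r - 1)) (v(r := 0))"
      unfolding clear_def fun_upd_upd .
    have "v r \<noteq> 0" using Suc.prems by simp
    from LoopS[OF this Skip loop] show ?case unfolding clear_def .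
  qed
  then show ?thesis by blast
qed

text \<open>Reading a register empties it. A copy therefore needs two receivers, one of which
  restores the original afterwards.\<close>

lemma bigstep_transfer:
  assumes "r \<noteq> p" "r \<noteq> q" "p \<noteq> q"
  shows "bigstep (Loop r (Seq (Inc p) (Inc q))) v (v(p := v p + v r, q := v q + v r, r := 0))"
proof -
  have "bigstep (Loop r (Seq (Inc p) (Inc q))) v (v(p := v p + n, q := v q + n, r := 0))"
    if "v r = n" for n
    using that
  proof (induction n arbitrary: v)
    case 0
    then have "v(p := v p + 0, q := v q + 0, r := 0) = v" by auto
    then show ?case using Loop0[of v r] 0 by simp
  next
    case (Suc n)
    let ?w = "v(r := v r - 1)"
    let ?w' = "?w(p := Suc (?w p))"
    let ?u = "?w'(q := Suc (?w' q))"
    have "bigstep (Loop r (Seq (Inc p) (Inc q))) ?u (?u(p := ?u p + n, q := ?u q + n, r := 0))"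
      using Suc.prems assms by (intro Suc.IH) auto
    moreover have "?u(p := ?u p + n, q := ?u q + n, r := 0) = v(p := v p + Suc n, q := v q + Suc n, r := 0)"
      using assms by (intro ext) auto
    ultimately have loop: "bigstep (Loop r (Seq (Inc p) (Inc q))) ?u (v(p := v p + Suc n, q := v q + Suc n, r := 0))"
      by (simp only:)
    have "v r \<noteq> 0" using Suc.prems by simp
    from LoopS[OF this Seq[OF Inc Inc] loop] show ?case .
  qed
  then show ?thesis by blast
qed

text \<open>The second temporary \<open>Suc t\<close> only serves to give both loops the same shape.\<close>

definition copy :: "nat \<Rightarrow> nat \<Rightarrow> nat \<Rightarrow> com" where
  "copy r p t = Seq (Seq (clear p) (clear t))
     (Seq (Loop r (Seq (Inc p) (Inc t))) (Loop t (Seq (Inc r) (Inc (Suc t)))))"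

lemma bigstep_copy:
  assumes "r \<noteq> p" "r < t" "p < t"
  shows "\<exists>v'. bigstep (copy r p t) v v' \<and> v' p = v r \<and> (\<forall>i<t. i \<noteq> p \<longrightarrow> v' i = v i)"
proof -
  let ?w = "v(p := 0, t := 0)"
  let ?w' = "?w(p := ?w p + ?w r, t := ?w t + ?w r, r := 0)"
  let ?u = "?w'(r := ?w' r + ?w' t, Suc t := ?w' (Suc t) + ?w' t, t := 0)"
  have "bigstep (copy r p t) v ?u"
    unfolding copy_def using assms
    by (intro Seq[OF Seq[OF bigstep_clear bigstep_clear] Seq[OF bigstep_transfer bigstep_transfer]]) auto
  then show ?thesis using assms by (intro exI[of _ ?u]) auto
qed

text \<open>In \<open>implements a f as d t\<close>, the registers from \<open>t\<close> on are scratch space.\<close>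

definition implements :: "com \<Rightarrow> recf \<Rightarrow> nat list \<Rightarrow> nat \<Rightarrow> nat \<Rightarrow> bool" where
  "implements a f as d t \<longleftrightarrow> (\<forall>y v. eval f (map v as) y \<longrightarrow>
     (\<exists>v'. bigstep a v v' \<and> v' d = y \<and> (\<forall>i<t. i \<noteq> d \<longrightarrow> v' i = v i)))"

lemma implementsD:
  assumes "implements a f as d t" "eval f xs y" "map v as = xs"
  obtains v' where "bigstep a v v'" "v' d = y" "\<And>i. i < t \<Longrightarrow> i \<noteq> d \<Longrightarrow> v' i = v i"
  using assms unfolding implements_def by blast

section \<open>Translation of recursive functions into commands\<close>

inductive_cases eval_ZeroE: "eval Zero xs y"
inductive_cases eval_SuccE: "eval Succ xs y"
inductive_cases eval_ProjE: "eval (Proj i) xs y"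
inductive_cases eval_CompE: "eval (Comp f gs) xs y"
inductive_cases eval_PrimE: "eval (Prim f g) xs y"
inductive_cases eval_MiniE: "eval (Mini f) xs y"

text \<open>The results go to consecutive registers. The frame condition \<open>i < d\<close> grows
  with \<open>d\<close> along the induction, so the later functions overwrite neither the arguments
  nor the results already computed.\<close>

lemma implements_list:
  assumes "\<And>g e. g \<in> set gs \<Longrightarrow> d \<le> e \<Longrightarrow> e < t \<Longrightarrow> \<exists>a. implements a g as e t"
    and "\<forall>i\<in>set as. i < d" "d + length gs \<le> t"
  shows "\<exists>a. \<forall>ys v. list_all2 (\<lambda>g y. eval g (map v as) y) gs ys \<longrightarrow>
     (\<exists>v'. bigstep a v v' \<and> map v' [d..<d + length gs] = ys \<and> (\<forall>i<d. v' i = v i))"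
  using assms
proof (induction gs arbitrary: d)
  case Nil
  then show ?case by (auto intro!: exI[of _ Skip] bigstep.Skip)
next
  case (Cons g gs)
  obtain a where a: "implements a g as d t" using Cons.prems(1)[of g d] Cons.prems(3) by auto
  have "\<exists>b. \<forall>ys v. list_all2 (\<lambda>g y. eval g (map v as) y) gs ys \<longrightarrow>
     (\<exists>v'. bigstep b v v' \<and> map v' [Suc d..<Suc d + length gs] = ys \<and> (\<forall>i<Suc d. v' i = v i))"
  proof (rule Cons.IH)
    show "\<forall>i\<in>set as. i < Suc d" using Cons.prems(2) by auto
  qed (use Cons.prems in auto)
  then obtain b where b: "\<And>ys v. list_all2 (\<lambda>g y. eval g (map v as) y) gs ys \<Longrightarrow>
     (\<exists>v'. bigstep b v v' \<and> map v' [Suc d..<Suc d + length gs] = ys \<and> (\<forall>i<Suc d. v' i = v i))"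
    by blast
  show ?case
  proof (intro exI[of _ "Seq a b"] allI impI)
    fix zs v assume "list_all2 (\<lambda>g y. eval g (map v as) y) (g # gs) zs"
    then obtain y ys where zs: "zs = y # ys" and y: "eval g (map v as) y"
      and ys: "list_all2 (\<lambda>g y. eval g (map v as) y) gs ys"
      by (auto simp: list_all2_Cons1)
    obtain v' where v': "bigstep a v v'" "v' d = y" "\<And>i. i < t \<Longrightarrow> i \<noteq> d \<Longrightarrow> v' i = v i"
      using implementsD[OF a y refl] by blast
    have "map v' as = map v as" using v'(3) Cons.prems by fastforce
    then obtain v'' where v'': "bigstep b v' v''" "map v'' [Suc d..<Suc d + length gs] = ys"
      "\<forall>i<Suc d. v'' i = v' i"
      using b[of v' ys] ys by metis
    show "\<exists>v'. bigstep (Seq a b) v v' \<and> map v' [d..<d + length (g # gs)] = zs \<and> (\<forall>i<d. v' i = v i)"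
      using v' v'' Cons.prems(3) zs
      by (intro exI[of _ v'']) (auto simp: upt_conv_Cons simp del: upt_Suc intro: Seq)
  qed
qed

text \<open>Registers are allocated like a stack: each construct takes what it needs from
  \<open>t\<close> on and hands a larger \<open>t\<close> to its parts. As the result register is
  not an argument and everything else below \<open>t\<close> is preserved, the arguments
  survive.\<close>

lemma implements_exists:
  "\<forall>i\<in>set as. i < t \<Longrightarrow> d \<notin> set as \<Longrightarrow> d < t \<Longrightarrow> \<exists>a. implements a f as d t"
proof (induction f arbitrary: as d t)
  case Zero
  have "implements (clear d) Zero as d t"
    unfolding implements_def
    by (intro allI impI exI[of _ "_(d := 0)"]) (auto intro: bigstep_clear elim: eval_ZeroE)
  then show ?case ..
next
  case Succ
  show ?case
  proof (cases as)
    case Nil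
    then show ?thesis unfolding implements_def by (auto elim: eval_SuccE)
  next
    case (Cons r rs)
    have "implements (Seq (copy r d t) (Inc d)) Succ as d t"
      unfolding implements_def
    proof (intro allI impI)
      fix y v assume "eval Succ (map v as) y"
      then have y: "y = Suc (v r)" using Cons by (auto elim: eval_SuccE)
      obtain v' where v': "bigstep (copy r d t) v v'" "v' d = v r" "\<forall>i<t. i \<noteq> d \<longrightarrow> v' i = v i"
        using bigstep_copy[of r d t v] Succ Cons by auto
      show "\<exists>v'. bigstep (Seq (copy r d t) (Inc d)) v v' \<and> v' d = y \<and> (\<forall>i<t. i \<noteq> d \<longrightarrow> v' i = v i)"
        using Seq[OF v'(1) Inc[of d v']] v' y by (intro exI[of _ "v'(d := Suc (v' d))"]) simp
    qed
    then show ?thesis ..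
  qed
next
  case (Proj i)
  have "implements (copy (as ! i) d t) (Proj i) as d t"
    unfolding implements_def
  proof (intro allI impI)
    fix y v assume "eval (Proj i) (map v as) y"
    then have "i < length as" "y = v (as ! i)" by (auto elim: eval_ProjE)
    then show "\<exists>v'. bigstep (copy (as ! i) d t) v v' \<and> v' d = y \<and> (\<forall>i<t. i \<noteq> d \<longrightarrow> v' i = v i)"
      using bigstep_copy[of "as ! i" d t v] Proj by (metis nth_mem)
  qed
  then show ?case ..
next
  case (Comp f gs)
  let ?u = "t + length gs"
  have "\<exists>a. \<forall>ys v. list_all2 (\<lambda>g y. eval g (map v as) y) gs ys \<longrightarrow>
     (\<exists>v'. bigstep a v v' \<and> map v' [t..<?u] = ys \<and> (\<forall>i<t. v' i = v i))"
  proof (rule implements_list)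
    fix g e assume "g \<in> set gs" "t \<le> e" "e < ?u"
    then show "\<exists>a. implements a g as e ?u"
      using Comp.prems by (intro Comp.IH(2)) fastforce+
  qed (use Comp.prems in auto)
  then obtain a where a: "\<And>ys v. list_all2 (\<lambda>g y. eval g (map v as) y) gs ys \<Longrightarrow>
     \<exists>v'. bigstep a v v' \<and> map v' [t..<?u] = ys \<and> (\<forall>i<t. v' i = v i)"
    by blast
  obtain b where b: "implements b f [t..<?u] d ?u"
    using Comp.IH(1)[of "[t..<?u]" ?u d] Comp.prems by auto
  have "implements (Seq a b) (Comp f gs) as d t"
    unfolding implements_def
  proof (intro allI impI)
    fix y v assume "eval (Comp f gs) (map v as) y"
    then obtain ys where ys: "list_all2 (\<lambda>g y. eval g (map v as) y) gs ys" "eval f ys y"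
      by (auto elim: eval_CompE)
    obtain v' where v': "bigstep a v v'" "map v' [t..<?u] = ys" "\<forall>i<t. v' i = v i"
      using a[OF ys(1)] by blast
    obtain v'' where v'': "bigstep b v' v''" "v'' d = y" "\<And>i. i < ?u \<Longrightarrow> i \<noteq> d \<Longrightarrow> v'' i = v' i"
      using implementsD[OF b ys(2) v'(2)] by blast
    show "\<exists>v'. bigstep (Seq a b) v v' \<and> v' d = y \<and> (\<forall>i<t. i \<noteq> d \<longrightarrow> v' i = v i)"
      using Seq[OF v'(1) v''(1)] v'(3) v''(2,3) by (intro exI[of _ v'']) auto
  qed
  then show ?case ..
next
  case (Prim f g)
  show ?case
  proof (cases as)
    case Nil
    then show ?thesis unfolding implements_def by (auto elim: eval_PrimE)
  next
    case (Cons r rs)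
    \<comment> \<open>\<open>cnt\<close> counts the remaining rounds down, \<open>i\<close> counts
      up because \<open>g\<close> receives the index of the round. The value of \<open>g\<close>
      goes to \<open>tmp\<close>, since its result register must differ from its argument
      \<open>acc\<close>.\<close>
    define cnt i acc tmp u where "cnt = t" "i = t + 1" "acc = t + 2" "tmp = t + 3" "u = t + 4"
    note regs = this
    have rs: "\<forall>j\<in>set rs. j < t" "r < t" using Prim.prems Cons by auto
    obtain a where a: "implements a f rs acc u"
      using Prim.IH(1)[of rs u acc] rs by (fastforce simp: regs)
    obtain b where b: "implements b g (i # acc # rs) tmp u"
      using Prim.IH(2)[of "i # acc # rs" u tmp] rs by (fastforce simp: regs)
    define body where "body = Seq b (Seq (copy tmp acc u) (Inc i))"
    define prog where "prog = Seq (Seq (copy r cnt u) (Seq (clear i) a)) (Seq (Loop cnt body) (copy acc d u))"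
    have "implements prog (Prim f g) as d t"
      unfolding implements_def
    proof (intro allI impI)
      fix y v assume ev: "eval (Prim f g) (map v as) y"
      define xs n where "xs = map v rs" and "n = v r"
      \<comment> \<open>As \<open>eval\<close> is a relation, the intermediate values of the
        recursion are read off the derivation as a sequence \<open>Y\<close>.\<close>
      have "eval (Prim f g) (n # xs) y \<Longrightarrow>
        \<exists>Y. Y n = y \<and> eval f xs (Y 0) \<and> (\<forall>k<n. eval g (k # Y k # xs) (Y (Suc k)))" for n y
      proof (induction n arbitrary: y)
        case 0
        then show ?case by (auto elim: eval_PrimE)
      next
        case (Suc n)
        then obtain z where z: "eval (Prim f g) (n # xs) z" "eval g (n # z # xs) y"
          by (auto elim: eval_PrimE)
        obtain Y where Y: "Y n = z" "eval f xs (Y 0)" "\<forall>k<n. eval g (k # Y k # xs) (Y (Suc k))"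
          using Suc.IH[OF z(1)] by blast
        show ?case
          using Y z by (intro exI[of _ "Y(Suc n := y)"]) (auto simp: less_Suc_eq)
      qed
      then obtain Y where Y: "Y n = y" "eval f xs (Y 0)" "\<And>k. k < n \<Longrightarrow> eval g (k # Y k # xs) (Y (Suc k))"
        using ev Cons unfolding xs_def n_def by fastforce
      \<comment> \<open>Loop invariant: \<open>acc\<close> holds \<open>Y i\<close>, and
        \<open>cnt\<close> and \<open>i\<close> add up to \<open>n\<close>.\<close>
      have loop: "\<exists>w'. bigstep (Loop cnt body) w w' \<and> w' acc = y \<and> (\<forall>j<t. w' j = v j)"
        if "w cnt = m" "w i + m = n" "w acc = Y (w i)" "\<And>j. j < t \<Longrightarrow> w j = v j" for w m
        using that
      proof (induction m arbitrary: w)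
        case 0
        then show ?case using Loop0[of w cnt body] Y(1) by auto
      next
        case (Suc m)
        define w1 where "w1 = w(cnt := w cnt - 1)"
        have w1: "w1 cnt = m" "w1 i = w i" "w1 acc = Y (w1 i)" "\<And>j. j < t \<Longrightarrow> w1 j = v j"
          using Suc.prems unfolding w1_def regs by auto
        have "map w1 (i # acc # rs) = w1 i # Y (w1 i) # xs"
          using w1 rs unfolding xs_def by auto
        moreover have "eval g (w1 i # Y (w1 i) # xs) (Y (Suc (w1 i)))"
          using Y(3)[of "w1 i"] w1 Suc.prems by auto
        ultimately obtain w2 where w2: "bigstep b w1 w2" "w2 tmp = Y (Suc (w1 i))"
          "\<And>j. j < u \<Longrightarrow> j \<noteq> tmp \<Longrightarrow> w2 j = w1 j"
          using implementsD[OF b] by metis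
        obtain w3 where w3: "bigstep (copy tmp acc u) w2 w3" "w3 acc = w2 tmp"
          "\<And>j. j < u \<Longrightarrow> j \<noteq> acc \<Longrightarrow> w3 j = w2 j"
          using bigstep_copy[of tmp acc u w2] regs by auto
        define w4 where "w4 = w3(i := Suc (w3 i))"
        have body: "bigstep body w1 w4"
          unfolding body_def w4_def by (intro Seq[OF w2(1)] Seq[OF w3(1)] Inc)
        have "\<exists>w'. bigstep (Loop cnt body) w4 w' \<and> w' acc = y \<and> (\<forall>j<t. w' j = v j)"
          by (rule Suc.IH) (use w1 w2(2,3) w3(2,3) Suc.prems in \<open>auto simp: w4_def regs\<close>)
        then show ?case
          using LoopS[of w cnt body w4] body Suc.prems(1) unfolding w1_def by auto
      qed
      obtain v1 where v1: "bigstep (copy r cnt u) v v1" "v1 cnt = v r"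
        "\<And>j. j < u \<Longrightarrow> j \<noteq> cnt \<Longrightarrow> v1 j = v j"
        using bigstep_copy[of r cnt u v] regs rs by auto
      define v2 where "v2 = v1(i := 0)"
      have "map v2 rs = xs"
        unfolding xs_def v2_def using v1 rs by (auto simp: regs)
      then obtain v3 where v3: "bigstep a v2 v3" "v3 acc = Y 0"
        "\<And>j. j < u \<Longrightarrow> j \<noteq> acc \<Longrightarrow> v3 j = v2 j"
        using implementsD[OF a Y(2)] by metis
      obtain v4 where v4: "bigstep (Loop cnt body) v3 v4" "v4 acc = y" "\<And>j. j < t \<Longrightarrow> v4 j = v j"
        using loop[of v3 n] v1(2,3) v3(2,3) n_def unfolding v2_def regs by auto
      obtain v5 where v5: "bigstep (copy acc d u) v4 v5" "v5 d = v4 acc"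
        "\<And>j. j < u \<Longrightarrow> j \<noteq> d \<Longrightarrow> v5 j = v4 j"
        using bigstep_copy[of acc d u v4] regs Prim.prems by auto
      have "bigstep (clear i) v1 v2" unfolding v2_def by (rule bigstep_clear)
      then have "bigstep prog v v5"
        unfolding prog_def
        by (rule Seq[OF Seq[OF v1(1) Seq[OF _ v3(1)]] Seq[OF v4(1) v5(1)]])
      then show "\<exists>v'. bigstep prog v v' \<and> v' d = y \<and> (\<forall>j<t. j \<noteq> d \<longrightarrow> v' j = v j)"
        using v4(2,3) v5(2,3) regs by (intro exI[of _ v5]) auto
    qed
    then show ?thesis ..
  qed
next
  case (Mini f)
  define i tmp u where "i = t" "tmp = t + 1" "u = t + 2"
  note regs = this
  have as: "\<forall>j\<in>set as. j < t" using Mini.prems by auto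
  obtain a where a: "implements a f (i # as) tmp u"
    using Mini.IH[of "i # as" u tmp] as by (fastforce simp: regs)
  define body where "body = Seq (Inc i) a"
  define prog where "prog = Seq (Seq (clear i) a) (Seq (Loop tmp body) (copy i d u))"
  have "implements prog (Mini f) as d t"
    unfolding implements_def
  proof (intro allI impI)
    fix n v assume ev: "eval (Mini f) (map v as) n"
    define xs where "xs = map v as"
    have n: "eval f (n # xs) 0" "\<forall>k<n. \<exists>y. eval f (k # xs) (Suc y)"
      using ev unfolding xs_def by (auto elim: eval_MiniE)
    then obtain Y where Y: "\<And>k. k < n \<Longrightarrow> eval f (k # xs) (Suc (Y k))" by metis
    \<comment> \<open>\<open>Z\<close> lists the values of \<open>f\<close> up to \<open>n\<close>:
      positive below \<open>n\<close> and 0 at \<open>n\<close>, so a loop on the last value stops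
      exactly at the minimum.\<close>
    define Z where "Z k = (if k < n then Suc (Y k) else 0)" for k
    have Z: "eval f (k # xs) (Z k)" if "k \<le> n" for k
      using that Y n unfolding Z_def by (cases "k = n") auto
    have run: "\<exists>w'. bigstep a w w' \<and> w' i = w i \<and> w' tmp = Z (w i) \<and> (\<forall>j<t. w' j = v j)"
      if "w i \<le> n" "\<And>j. j < t \<Longrightarrow> w j = v j" for w
    proof -
      have "map w (i # as) = w i # xs" using that as unfolding xs_def by auto
      then show ?thesis
        using implementsD[OF a Z[OF that(1)]] that(2) unfolding regs
        by (smt (verit) add.commute less_add_one less_add_same_cancel1 n_not_Suc_n nat_less_le
            plus_1_eq_Suc trans_less_add1 zero_less_numeral)
    qed
    have loop: "\<exists>w'. bigstep (Loop tmp body) w w' \<and> w' i = n \<and> (\<forall>j<t. w' j = v j)"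
      if "w i + m = n" "w tmp = Z (w i)" "\<And>j. j < t \<Longrightarrow> w j = v j" for w m
      using that
    proof (induction m arbitrary: w)
      case 0
      then show ?case using Loop0[of w tmp body] unfolding Z_def by auto
    next
      case (Suc m)
      \<comment> \<open>The loop test takes one away from \<open>tmp\<close>; this does no harm
        because the body recomputes \<open>tmp\<close>.\<close>
      define w1 where "w1 = w(tmp := w tmp - 1)"
      define w2 where "w2 = w1(i := Suc (w1 i))"
      have w2: "w2 i = Suc (w i)" "\<And>j. j < t \<Longrightarrow> w2 j = v j"
        using Suc.prems unfolding w1_def w2_def regs by auto
      obtain w3 where w3: "bigstep a w2 w3" "w3 i = w2 i" "w3 tmp = Z (w2 i)" "\<forall>j<t. w3 j = v j"
        using run[of w2] w2 Suc.prems by auto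
      have body: "bigstep body w1 w3"
        unfolding body_def by (rule Seq[OF _ w3(1)]) (simp only: w2_def bigstep.Inc)
      have "\<exists>w'. bigstep (Loop tmp body) w3 w' \<and> w' i = n \<and> (\<forall>j<t. w' j = v j)"
        by (rule Suc.IH) (use w2 w3 Suc.prems in auto)
      moreover have "w tmp \<noteq> 0" using Suc.prems unfolding Z_def by auto
      ultimately show ?case
        using LoopS[of w tmp body w3] body unfolding w1_def by auto
    qed
    define v1 where "v1 = v(i := 0)"
    obtain v2 where v2: "bigstep a v1 v2" "v2 i = v1 i" "v2 tmp = Z (v1 i)" "\<forall>j<t. v2 j = v j"
      using run[of v1] unfolding v1_def regs by auto
    obtain v3 where v3: "bigstep (Loop tmp body) v2 v3" "v3 i = n" "\<forall>j<t. v3 j = v j"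
      using loop[of v2 n] v2 unfolding v1_def by auto
    obtain v4 where v4: "bigstep (copy i d u) v3 v4" "v4 d = v3 i"
      "\<And>j. j < u \<Longrightarrow> j \<noteq> d \<Longrightarrow> v4 j = v3 j"
      using bigstep_copy[of i d u v3] regs Mini.prems by auto
    have "bigstep prog v v4"
      unfolding prog_def
      by (intro Seq[OF Seq[OF _ v2(1)] Seq[OF v3(1) v4(1)]]) (simp only: v1_def bigstep_clear)
    then show "\<exists>v'. bigstep prog v v' \<and> v' d = n \<and> (\<forall>j<t. j \<noteq> d \<longrightarrow> v' j = v j)"
      using v3(2,3) v4(2,3) regs by (intro exI[of _ v4]) auto
  qed
  then show ?case ..
qed

section \<open>A universal function\<close>

text \<open>A state is coded by \<open>\<Prod>r. base r ^ v r\<close>. The primes of the input register 0 and of the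
  output register 1 are fixed because the simulation has to refer to them.\<close>

definition base :: "nat \<Rightarrow> nat" where
  "base = (SOME q. inj q \<and> (\<forall>r. prime (q r)) \<and> q 0 = 2 \<and> q 1 = 3)"

lemma base: "inj base" "prime (base r)" "base 0 = 2" "base 1 = 3"
proof -
  have "infinite ({p :: nat. prime p} - {2, 3})" using primes_infinite by simp
  from infinite_countable_subset[OF this]
  obtain f :: "nat \<Rightarrow> nat" where "inj f \<and> range f \<subseteq> {p. prime p} - {2, 3}" ..
  then have f: "inj f" "range f \<subseteq> {p. prime p} - {2, 3}" by simp_all
  define q where "q = case_nat 2 (case_nat 3 f)"
  have "f i \<noteq> 2" "f i \<noteq> 3" "2 \<noteq> f i" "3 \<noteq> f i" "prime (f i)" for i
    using subsetD[OF f(2) rangeI, of i] by auto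
  then have "inj q \<and> (\<forall>r. prime (q r)) \<and> q 0 = 2 \<and> q 1 = 3"
    using f(1) unfolding q_def by (auto intro!: injI dest: injD split: nat.splits)
  then have "inj base \<and> (\<forall>r. prime (base r)) \<and> base 0 = 2 \<and> base 1 = 3"
    unfolding base_def by (rule someI[of "\<lambda>q. inj q \<and> (\<forall>r. prime (q r)) \<and> q 0 = 2 \<and> q 1 = 3"])
  then show "inj base" "prime (base r)" "base 0 = 2" "base 1 = 3" by auto
qed

definition godel :: "nat \<Rightarrow> (nat \<Rightarrow> nat) \<Rightarrow> nat" where
  "godel R v = (\<Prod>r<R. base r ^ v r)"

text \<open>With \<open>x\<close> free this serves both directions: \<open>x = v r\<close> for an
  increment, \<open>x = v r - 1\<close> for a decrement.\<close>

lemma godel_Suc: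
  assumes "r < R"
  shows "godel R (v(r := Suc x)) = godel R (v(r := x)) * base r"
proof -
  have "(\<Prod>i\<in>{..<R} - {r}. base i ^ (v(r := Suc x)) i) = (\<Prod>i\<in>{..<R} - {r}. base i ^ (v(r := x)) i)"
    by (rule prod.cong) auto
  then show ?thesis
    using assms unfolding godel_def by (simp add: prod.remove[of "{..<R}" r])
qed

text \<open>Distinct primes make the zero test of a register a divisibility test on the
  state.\<close>

lemma base_dvd_godel_iff: "r < R \<Longrightarrow> base r dvd godel R v \<longleftrightarrow> v r \<noteq> 0"
proof
  assume r: "r < R" and "base r dvd godel R v"
  then obtain i where i: "i < R" "base r dvd base i ^ v i"
    unfolding godel_def using base(2) by (auto simp: prime_dvd_prod_iff)
  then have "base r dvd base i" using base(2) prime_dvd_power by blast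
  then have "base r = base i" using base(2) primes_dvd_imp_eq by blast
  then have "r = i" using base(1) by (simp add: injD)
  moreover have "v i \<noteq> 0"
  proof
    assume "v i = 0"
    then have "is_unit (base r)" using i by simp
    then show False using base(2)[of r] not_prime_unit by blast
  qed
  ultimately show "v r \<noteq> 0" by simp
next
  assume "r < R" "v r \<noteq> 0"
  then show "base r dvd godel R v"
    using godel_Suc[of r R v "v r - 1"] by simp
qed

lemma godel_initial: "0 < R \<Longrightarrow> godel R ((\<lambda>_. 0)(0 := n)) = 2 ^ n"
proof -
  assume "0 < R"
  then have "godel R ((\<lambda>_. 0)(0 := n)) = (\<Prod>r<R. if r = 0 then 2 ^ n else 1)"
    unfolding godel_def using base(3) by (intro prod.cong) auto
  then show ?thesis using \<open>0 < R\<close> by (simp add: prod.delta)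
qed

text \<open>The code of \<open>(a, b, j, k)\<close> stands for: if \<open>Suc b\<close> divides the state, multiply it by
  \<open>a / Suc b\<close> and go to \<open>j\<close>, otherwise go to \<open>k\<close>.\<close>

fun instr_code :: "instr \<Rightarrow> nat" where
  "instr_code (INC r j) = prod_encode (base r, prod_encode (0, prod_encode (j, j)))"
| "instr_code (DEC r j k) = prod_encode (1, prod_encode (base r - 1, prod_encode (j, k)))"

definition program_code :: "instr list \<Rightarrow> nat" where
  "program_code P = list_encode (map instr_code P)"

lemma instr_code_neq_0: "instr_code i \<noteq> 0"
proof -
  have "base r \<noteq> 0" for r using base(2)[of r] by auto
  then show ?thesis by (cases i) (auto simp: prod_encode_def)
qed

text \<open>A step in the style of Conway's fraction programs, on the pair of address and state
  number. Tests are available only against 0, so equality is expressed by two truncated differences;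
  they both vanish exactly when \<open>Suc b\<close> divides \<open>s\<close>.\<close>

definition simulate_step :: "nat \<Rightarrow> nat \<Rightarrow> nat" where
  "simulate_step n z =
    (let i = nth_code n (fst (prod_decode z)); s = snd (prod_decode z);
       a = fst (prod_decode i); i' = snd (prod_decode i);
       b = fst (prod_decode i'); t = snd (prod_decode i'); q = quot s b
     in if s - q * Suc b = 0 then (if q * Suc b - s = 0 then prod_encode (fst (prod_decode t), q * a)
           else prod_encode (snd (prod_decode t), s)) else 0)"

text \<open>\<open>R\<close> occurs in the proof but not in the simulator, which works on the state
  number alone; so each program may be treated with an \<open>R\<close> of its own.\<close>

lemma simulate_step:
  assumes "step P (pc, v) (pc', v')" "\<forall>i\<in>set P. instr_reg i < R"
  shows "simulate_step (program_code P) (prod_encode (pc, godel R v)) = prod_encode (pc', godel R v')"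
proof -
  have pc: "pc < length P" "(pc', v') = exec (P ! pc) v" using assms unfolding step_def by auto
  have code: "nth_code (program_code P) pc = instr_code (P ! pc)"
    unfolding program_code_def nth_code_list_encode using pc by simp
  have R: "instr_reg (P ! pc) < R" using assms(2) pc(1) by simp
  have le: "s - quot s b * Suc b = 0" for s b
    unfolding quot_def by (rule LeastI[of _ s]) simp
  show ?thesis
  proof (cases "P ! pc")
    case (INC r j)
    have "godel R v' = godel R v * base r"
      using godel_Suc[of r R v "v r"] R pc(2) INC by simp
    then show ?thesis
      using pc(2) quot_mult[of "godel R v" 0] unfolding simulate_step_def Let_def by (simp add: code INC)
  next
    case (DEC r j k)
    have b: "Suc (base r - 1) = base r" using base(2)[of r] prime_gt_0_nat by fastforce
    let ?q = "quot (godel R v) (base r - 1)"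
    have dvd: "?q * base r = godel R v \<longleftrightarrow> v r \<noteq> 0"
      using quot_dvd_iff[of "godel R v" "base r - 1"] base_dvd_godel_iff[of r R v] R DEC b by simp
    have le: "godel R v \<le> ?q * base r" using le[of "godel R v" "base r - 1"] b by simp
    show ?thesis
    proof (cases "v r = 0")
      case True
      then have "?q * base r > godel R v" using dvd le by linarith
      then show ?thesis using True pc(2) unfolding simulate_step_def Let_def
        by (simp add: code DEC b del: mult_Suc_right One_nat_def)
    next
      case False
      then have "godel R v = godel R v' * base r"
        using godel_Suc[of r R v "v r - 1"] R pc(2) DEC by simp
      then have "?q = godel R v'" using quot_mult[of "godel R v'" "base r - 1"] b by simp
      then show ?thesis using False pc(2) dvd unfolding simulate_step_def Let_def
        by (simp add: code DEC b del: mult_Suc_right One_nat_def)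
    qed
  qed
qed

text \<open>\<open>n\<close> is both the program and its input, as diagonalisation runs a program on
  its own code; \<open>2 ^ n\<close> is the state with \<open>n\<close> in register 0.\<close>

definition simulate :: "nat \<Rightarrow> nat \<Rightarrow> nat" where
  "simulate n t = rec_nat (prod_encode (0, 2 ^ n)) (\<lambda>_ z. simulate_step n z) t"

lemma computable_simulate_step:
  assumes "computable k a" "computable k b"
  shows "computable k (\<lambda>xs. simulate_step (a xs) (b xs))"
  unfolding simulate_step_def Let_def
  by (intro computable_if0 computable_diff computable_mult computable_Suc computable_prod_encode
      computable_fst computable_snd computable_quot computable_nth_code computable_const assms)

lemma computable_simulate:
  assumes "computable k a" "computable k b"
  shows "computable k (\<lambda>xs. simulate (a xs) (b xs))"
proof (rule computable_2I[OF _ assms])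
  show "computable 2 (\<lambda>xs. simulate (xs ! 0) (xs ! 1))"
    unfolding simulate_def
    by (intro computable_rec_nat' computable_prod_encode computable_const computable_pow2
        computable_nth computable_simulate_step computable_drop2_nth) auto
qed

text \<open>\<open>Mini c\<close> searches for the time at which the fetched instruction code is 0.
  Codes of instructions are nonzero, so this is the moment when the run leaves the program.
  \<open>d\<close> then reads the output by asking whether \<open>Suc 2\<close>, the prime of
  register 1, divides the state.\<close>

lemma universal:
  obtains u where "\<And>P v. (step P)\<^sup>*\<^sup>* (0, (\<lambda>_. 0)(0 := program_code P)) (length P, v) \<Longrightarrow>
     eval u [program_code P] (if v 1 = 0 then 0 else 1)"
proof -
  have "computable 2 (\<lambda>xs. nth_code (xs ! 1) (fst (prod_decode (simulate (xs ! 1) (xs ! 0)))))"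
    by (intro computable_nth_code computable_fst computable_simulate computable_nth) auto
  then obtain c where c: "\<And>t n. eval c [t, n] (nth_code n (fst (prod_decode (simulate n t))))"
    by (rule computable_2E) (simp, blast)
  have "computable 2 (\<lambda>xs. if quot (snd (prod_decode (simulate (xs ! 1) (xs ! 0)))) 2 * Suc 2
     - snd (prod_decode (simulate (xs ! 1) (xs ! 0))) = 0 then 1 else 0)"
    by (intro computable_if0 computable_diff computable_mult computable_quot computable_snd
        computable_simulate computable_nth computable_const) auto
  then obtain d where d: "\<And>t n. eval d [t, n] (if quot (snd (prod_decode (simulate n t))) 2 * Suc 2
     - snd (prod_decode (simulate n t)) = 0 then 1 else 0)"
    by (rule computable_2E) (simp, blast)
  show ?thesis
  proof (rule that[of "Comp d [Mini c, Proj 0]"])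
    fix P v
    define n where "n = program_code P"
    assume "(step P)\<^sup>*\<^sup>* (0, (\<lambda>_. 0)(0 := program_code P)) (length P, v)"
    then obtain T f where f: "f 0 = (0, (\<lambda>_. 0)(0 := n))" "f T = (length P, v)"
      "\<And>t. t < T \<Longrightarrow> step P (f t) (f (Suc t))"
      unfolding n_def rtranclp_power relpowp_fun_conv by auto
    \<comment> \<open>The 1 is inserted so that the output register lies below \<open>R\<close> even
      if the program never mentions it.\<close>
    define R where "R = Max (insert 1 (instr_reg ` set P)) + 1"
    have "x < R" if "x \<in> insert 1 (instr_reg ` set P)" for x
      unfolding R_def using Max_ge[OF _ that] by simp
    then have R: "\<forall>i\<in>set P. instr_reg i < R" "1 < R" by auto
    have run: "simulate n t = prod_encode (fst (f t), godel R (snd (f t)))" if "t \<le> T" for t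
      using that
    proof (induction t)
      case 0
      have "godel R ((\<lambda>_. 0)(0 := n)) = 2 ^ n" using R by (intro godel_initial) simp
      then show ?case unfolding simulate_def f(1) fst_conv snd_conv by (simp only: nat.rec)
    next
      case (Suc t)
      then have "simulate n t = prod_encode (fst (f t), godel R (snd (f t)))" by simp
      then show ?case
        using simulate_step[of P "fst (f t)" "snd (f t)" "fst (f (Suc t))" "snd (f (Suc t))" R] R f(3)[of t] Suc.prems
        unfolding simulate_def n_def by simp
    qed
    have "eval (Mini c) [n] T"
    proof (rule eval_mini)
      have "nth_code n (fst (prod_decode (simulate n T))) = 0"
        using run[of T] f(2) unfolding n_def program_code_def by (simp add: nth_code_list_encode)
      then show "eval c [T, n] 0" using c[of T n] by simp
      show "\<forall>t<T. \<exists>k. eval c [t, n] (Suc k)"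
      proof (intro allI impI)
        fix t assume t: "t < T"
        have "nth_code n (fst (prod_decode (simulate n t))) = instr_code (P ! fst (f t))"
          using run[of t] t f(3)[OF t] unfolding n_def program_code_def
          by (simp add: nth_code_list_encode step_def)
        then show "\<exists>k. eval c [t, n] (Suc k)"
          using c[of t n] instr_code_neq_0 by (metis not0_implies_Suc)
      qed
    qed
    moreover have "eval (Proj 0) [n] n" using eval_proj[of 0 "[n]"] by simp
    ultimately have "list_all2 (\<lambda>g y. eval g [n] y) [Mini c, Proj 0] [T, n]" by simp
    moreover have "eval d [T, n] (if v 1 = 0 then 0 else 1)"
    proof -
      let ?s = "godel R v"
      have "?s - quot ?s 2 * Suc 2 = 0"
        unfolding quot_def by (rule LeastI[of _ ?s]) simp
      then have "quot ?s 2 * Suc 2 - ?s = 0 \<longleftrightarrow> quot ?s 2 * Suc 2 = ?s" by linarith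
      also have "\<dots> \<longleftrightarrow> v 1 \<noteq> 0"
        using quot_dvd_iff[of ?s 2] base_dvd_godel_iff[of 1 R v] R base(4) by simp
      finally show ?thesis using d[of T n] run[of T] f(2) by (simp split: if_splits)
    qed
    ultimately show "eval (Comp d [Mini c, Proj 0]) [program_code P] (if v 1 = 0 then 0 else 1)"
      unfolding n_def by (rule eval_comp)
  qed
qed

section \<open>Tilings as subset sums\<close>

text \<open>Edges carry sets of labels because each label is one coordinate of the module: matching
  edges means equality coordinate by coordinate, and the empty set is the edge towards empty
  space.\<close>

datatype ('m, 'h, 'v) tile =
  Tile (marks: "'m set") (west: "'h set") (east: "'h set") (south: "'v set") (north: "'v set")

abbreviation blank :: "('m, 'h, 'v) tile" where
  "blank \<equiv> Tile {} {} {} {} {}"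

text \<open>The disjoint sum keeps marks, horizontal and vertical matching in separate coordinates.
  Marks occur on the positive side only, so nothing cancels them.\<close>

definition out_labels :: "('m, 'h, 'v) tile \<Rightarrow> ('m + 'h + 'v) set" where
  "out_labels t = marks t <+> east t <+> north t"

definition west_labels :: "('m, 'h, 'v) tile \<Rightarrow> ('m + 'h + 'v) set" where
  "west_labels t = {} <+> west t <+> {}"

definition south_labels :: "('m, 'h, 'v) tile \<Rightarrow> ('m + 'h + 'v) set" where
  "south_labels t = {} <+> {} <+> south t"

lemma mem_labels [simp]:
  "Inl m \<in> out_labels t \<longleftrightarrow> m \<in> marks t" "Inr (Inl h) \<in> out_labels t \<longleftrightarrow> h \<in> east t"
  "Inr (Inr v) \<in> out_labels t \<longleftrightarrow> v \<in> north t"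
  "Inl m \<notin> west_labels t" "Inr (Inl h) \<in> west_labels t \<longleftrightarrow> h \<in> west t" "Inr (Inr v) \<notin> west_labels t"
  "Inl m \<notin> south_labels t" "Inr (Inl h) \<notin> south_labels t" "Inr (Inr v) \<in> south_labels t \<longleftrightarrow> v \<in> south t"
  by (auto simp: out_labels_def west_labels_def south_labels_def)

definition tile_vector ::
  "('m::countable, 'h::countable, 'v::countable) tile \<Rightarrow> (int \<times> int) \<times> nat \<Rightarrow> 'r::ring_1" where
  "tile_vector t = (\<lambda>((a, b), x).
     of_bool ((a, b) = (0, 0) \<and> x \<in> to_nat ` out_labels t)
     - of_bool ((a, b) = (-1, 0) \<and> x \<in> to_nat ` west_labels t)
     - of_bool ((a, b) = (0, -1) \<and> x \<in> to_nat ` south_labels t))"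

text \<open>The \<open>itself\<close> arguments are there because the index
  \<open>to_nat (Inl m)\<close> depends on the whole sum type, whereas \<open>M\<close> mentions
  marks alone.\<close>

definition mark_vector ::
  "('m::countable) itself \<Rightarrow> ('h::countable) itself \<Rightarrow> ('v::countable) itself \<Rightarrow>
   (int \<times> int \<Rightarrow> 'm set) \<Rightarrow> (int \<times> int) \<times> nat \<Rightarrow> 'r::ring_1" where
  "mark_vector _ _ _ M = (\<lambda>(g, x). of_bool (x \<in> to_nat ` (Inl ` M g :: ('m + 'h + 'v) set)))"

definition tiling ::
  "('m, 'h, 'v) tile set \<Rightarrow> (int \<times> int \<Rightarrow> 'm set) \<Rightarrow> (int \<times> int \<Rightarrow> ('m, 'h, 'v) tile) \<Rightarrow> bool" where
  "tiling T M \<tau> \<longleftrightarrow> finite {g. \<tau> g \<noteq> blank} \<and> range \<tau> \<subseteq> insert blank T \<and>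
     (\<forall>g. marks (\<tau> g) = M g) \<and>
     (\<forall>a b. east (\<tau> (a, b)) = west (\<tau> (a + 1, b))) \<and>
     (\<forall>a b. north (\<tau> (a, b)) = south (\<tau> (a, b + 1)))"

lemma of_bool_eq_iff_ring: "(of_bool P :: 'r::ring_1) = of_bool Q \<longleftrightarrow> P = Q"
  by (cases P; cases Q) auto

text \<open>A position receives contributions from the tiles at itself and at its east and north
  neighbours only. \<open>D\<close> may exceed the support, as a summation list may place
  \<open>blank\<close> if \<open>T\<close> contains it.\<close>

lemma sum_shift_tile_vector:
  fixes \<tau> :: "int \<times> int \<Rightarrow> ('m::countable, 'h::countable, 'v::countable) tile"
  assumes D: "finite D" "{g. \<tau> g \<noteq> blank} \<subseteq> D"
  shows "(\<Sum>g\<in>D. shift g (tile_vector (\<tau> g)) ((a, b), x) :: 'r::ring_1) =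
     of_bool (x \<in> to_nat ` out_labels (\<tau> (a, b)))
     - of_bool (x \<in> to_nat ` west_labels (\<tau> (a + 1, b)))
     - of_bool (x \<in> to_nat ` south_labels (\<tau> (a, b + 1)))"
proof -
  have pick: "(\<Sum>g\<in>D. of_bool (g = g0 \<and> x \<in> to_nat ` L (\<tau> g)) :: 'r) = of_bool (x \<in> to_nat ` L (\<tau> g0))"
    if "L blank = {}" for g0 and L :: "('m, 'h, 'v) tile \<Rightarrow> ('m + 'h + 'v) set"
  proof -
    have "(\<Sum>g\<in>D. of_bool (g = g0 \<and> x \<in> to_nat ` L (\<tau> g)) :: 'r) =
      (\<Sum>g\<in>D. if g = g0 then of_bool (x \<in> to_nat ` L (\<tau> g0)) else 0)"
      by (rule sum.cong) auto
    also have "\<dots> = of_bool (x \<in> to_nat ` L (\<tau> g0))"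
      using D(1) subsetD[OF D(2), of g0] that by (cases "\<tau> g0 = blank") auto
    finally show ?thesis .
  qed
  have "shift g (tile_vector (\<tau> g)) ((a, b), x) =
     (of_bool (g = (a, b) \<and> x \<in> to_nat ` out_labels (\<tau> g))
     - of_bool (g = (a + 1, b) \<and> x \<in> to_nat ` west_labels (\<tau> g))
     - of_bool (g = (a, b + 1) \<and> x \<in> to_nat ` south_labels (\<tau> g)) :: 'r)" for g
  proof -
    have "((a - fst g, b - snd g) = (0, 0)) = (g = (a, b))"
      "((a - fst g, b - snd g) = (-1, 0)) = (g = (a + 1, b))"
      "((a - fst g, b - snd g) = (0, -1)) = (g = (a, b + 1))"
      by (cases g; auto)+
    then show ?thesis unfolding shift_def tile_vector_def prod.case by (simp only:)
  qed
  moreover have "out_labels (blank :: ('m, 'h, 'v) tile) = {}" "west_labels (blank :: ('m, 'h, 'v) tile) = {}"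
    "south_labels (blank :: ('m, 'h, 'v) tile) = {}"
    unfolding out_labels_def west_labels_def south_labels_def by auto
  ultimately show ?thesis by (simp only: sum_subtractf pick)
qed

text \<open>At a mark, only the first and the last indicator can be nonzero; at an edge label, only
  the positive one and one of the subtracted ones. Either way the equation compares two indicators,
  which decides their equality whenever \<open>0 \<noteq> 1\<close>, in characteristic 2 as
  well.\<close>

lemma labels_eq_iff:
  fixes t t' t'' :: "('m::countable, 'h::countable, 'v::countable) tile"
  shows "(\<forall>x. (of_bool (x \<in> to_nat ` out_labels t) - of_bool (x \<in> to_nat ` west_labels t')
     - of_bool (x \<in> to_nat ` south_labels t'') :: 'r::ring_1) =
       of_bool (x \<in> to_nat ` (Inl ` M :: ('m + 'h + 'v) set))) \<longleftrightarrow>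
   marks t = M \<and> east t = west t' \<and> north t = south t''"
  (is "?L \<longleftrightarrow> ?R")
proof
  have inj: "to_nat l \<in> to_nat ` A \<longleftrightarrow> l \<in> A" for l :: "'m + 'h + 'v" and A
    by (simp add: inj_image_mem_iff)
  assume L: ?L
  have eq: "(of_bool (l \<in> out_labels t) - of_bool (l \<in> west_labels t')
     - of_bool (l \<in> south_labels t'') :: 'r) = of_bool (l \<in> Inl ` M)" for l :: "'m + 'h + 'v"
    using L[rule_format, of "to_nat l"] unfolding inj .
  have "(m \<in> marks t) = (m \<in> M)" for m
    using eq[of "Inl m"] by (simp add: of_bool_eq_iff_ring inj_image_mem_iff)
  moreover have "(h \<in> east t) = (h \<in> west t')" for h
    using eq[of "Inr (Inl h)"] by (simp add: of_bool_eq_iff_ring image_iff)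
  moreover have "(v \<in> north t) = (v \<in> south t'')" for v
    using eq[of "Inr (Inr v)"] by (simp add: of_bool_eq_iff_ring image_iff)
  ultimately show ?R by blast
next
  assume R: ?R
  show ?L
  proof
    fix x
    show "(of_bool (x \<in> to_nat ` out_labels t) - of_bool (x \<in> to_nat ` west_labels t')
     - of_bool (x \<in> to_nat ` south_labels t'') :: 'r) =
       of_bool (x \<in> to_nat ` (Inl ` M :: ('m + 'h + 'v) set))"
    proof (cases "\<exists>l :: 'm + 'h + 'v. x = to_nat l")
      case True
      then obtain l :: "'m + 'h + 'v" where x: "x = to_nat l" by blast
      have inj: "to_nat l \<in> to_nat ` A \<longleftrightarrow> l \<in> A" for A
        by (simp add: inj_image_mem_iff)
      show ?thesis unfolding x inj
        using R by (cases l rule: sum.exhaust; cases "projr l" rule: sum.exhaust)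
          (auto simp: image_iff)
    qed auto
  qed
qed

lemma subset_sum_iff_tiling:
  fixes T :: "('m::countable, 'h::countable, 'v::countable) tile set"
  shows "(mark_vector TYPE('m) TYPE('h) TYPE('v) M :: _ \<Rightarrow> 'r::ring_1) \<in> subset_sum_set (tile_vector ` T)
     \<longleftrightarrow> (\<exists>\<tau>. tiling T M \<tau>)"
proof -
  have eq: "mark_vector TYPE('m) TYPE('h) TYPE('v) M = (\<lambda>p. \<Sum>g\<in>D. shift g (tile_vector (\<tau> g)) p :: 'r)
     \<longleftrightarrow> (\<forall>a b. marks (\<tau> (a, b)) = M (a, b) \<and> east (\<tau> (a, b)) = west (\<tau> (a + 1, b)) \<and>
       north (\<tau> (a, b)) = south (\<tau> (a, b + 1)))"
    if D: "finite D" "{g. \<tau> g \<noteq> blank} \<subseteq> D" for D and \<tau> :: "int \<times> int \<Rightarrow> ('m, 'h, 'v) tile"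
  proof -
    have "mark_vector TYPE('m) TYPE('h) TYPE('v) M = (\<lambda>p. \<Sum>g\<in>D. shift g (tile_vector (\<tau> g)) p :: 'r)
     \<longleftrightarrow> (\<forall>a b x. (\<Sum>g\<in>D. shift g (tile_vector (\<tau> g)) ((a, b), x) :: 'r)
        = of_bool (x \<in> to_nat ` (Inl ` M (a, b) :: ('m + 'h + 'v) set)))"
      unfolding mark_vector_def fun_eq_iff by auto
    also have "\<dots> \<longleftrightarrow> (\<forall>a b. marks (\<tau> (a, b)) = M (a, b) \<and> east (\<tau> (a, b)) = west (\<tau> (a + 1, b)) \<and>
       north (\<tau> (a, b)) = south (\<tau> (a, b + 1)))"
      by (simp only: sum_shift_tile_vector[OF D] labels_eq_iff)
    finally show ?thesis .
  qed
  show ?thesis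
  proof
    assume "(mark_vector TYPE('m) TYPE('h) TYPE('v) M :: _ \<Rightarrow> 'r) \<in> subset_sum_set (tile_vector ` T)"
    then obtain gs and fs :: "((int \<times> int) \<times> nat \<Rightarrow> 'r) list" where
      fs: "length gs = length fs" "distinct gs" "set fs \<subseteq> tile_vector ` T" and
      M: "mark_vector TYPE('m) TYPE('h) TYPE('v) M = (\<lambda>p. \<Sum>i<length gs. shift (gs ! i) (fs ! i) p)"
      unfolding subset_sum_set_def by auto
    define t where "t i = inv_into T tile_vector (fs ! i)" for i
    have "fs ! i \<in> tile_vector ` T" if "i < length gs" for i
      using that fs by (metis nth_mem subsetD)
    then have t: "t i \<in> T" "tile_vector (t i) = fs ! i" if "i < length gs" for i
      using that unfolding t_def by (auto simp: inv_into_into f_inv_into_f)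
    define \<tau> where "\<tau> g = (if g \<in> set gs then t (the_inv_into {..<length gs} ((!) gs) g) else blank)" for g
    have bij: "bij_betw ((!) gs) {..<length gs} (set gs)" using fs(2) by (simp add: bij_betw_nth)
    have \<tau>: "\<tau> (gs ! i) = t i" if "i < length gs" for i
      using that bij unfolding \<tau>_def bij_betw_def by (simp add: the_inv_into_f_f)
    have "(\<Sum>g\<in>set gs. shift g (tile_vector (\<tau> g)) p) = (\<Sum>i<length gs. shift (gs ! i) (fs ! i) p)" for p
      unfolding sum.reindex_bij_betw[OF bij, symmetric] by (rule sum.cong) (auto simp: \<tau> t)
    then have "mark_vector TYPE('m) TYPE('h) TYPE('v) M = (\<lambda>p. \<Sum>g\<in>set gs. shift g (tile_vector (\<tau> g)) p :: 'r)"
      unfolding M by simp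
    then have "\<forall>a b. marks (\<tau> (a, b)) = M (a, b) \<and> east (\<tau> (a, b)) = west (\<tau> (a + 1, b)) \<and>
       north (\<tau> (a, b)) = south (\<tau> (a, b + 1))"
      by (subst (asm) eq) (auto simp: \<tau>_def)
    moreover have "finite {g. \<tau> g \<noteq> blank}"
      by (rule finite_subset[of _ "set gs"]) (auto simp: \<tau>_def)
    moreover have "range \<tau> \<subseteq> insert blank T"
    proof
      fix t' assume "t' \<in> range \<tau>"
      then obtain g where g: "t' = \<tau> g" by blast
      show "t' \<in> insert blank T"
      proof (cases "g \<in> set gs")
        case True
        then obtain i where "i < length gs" "g = gs ! i" by (metis in_set_conv_nth)
        then show ?thesis using g \<tau> t by simp
      qed (simp add: \<tau>_def g)
    qed
    ultimately have "tiling T M \<tau>" unfolding tiling_def by simp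
    then show "\<exists>\<tau>. tiling T M \<tau>" by (intro exI)
  next
    assume "\<exists>\<tau>. tiling T M \<tau>"
    then obtain \<tau> where \<tau>: "tiling T M \<tau>" ..
    define D where "D = {g. \<tau> g \<noteq> blank}"
    have D: "finite D" "{g. \<tau> g \<noteq> blank} \<subseteq> D" "\<And>g. g \<in> D \<Longrightarrow> \<tau> g \<in> T"
      using \<tau> unfolding tiling_def D_def by auto
    obtain gs where gs: "set gs = D" "distinct gs" using finite_distinct_list[OF D(1)] by blast
    have bij: "bij_betw ((!) gs) {..<length gs} D" using gs by (auto intro: bij_betw_nth)
    have "mark_vector TYPE('m) TYPE('h) TYPE('v) M = (\<lambda>p. \<Sum>g\<in>D. shift g (tile_vector (\<tau> g)) p :: 'r)"
      using \<tau> unfolding eq[OF D(1,2)] tiling_def by auto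
    also have "\<dots> = (\<lambda>p. \<Sum>i<length gs. shift (gs ! i) (map (\<lambda>g. tile_vector (\<tau> g)) gs ! i) p)"
      unfolding sum.reindex_bij_betw[OF bij, symmetric] by simp
    finally show "(mark_vector TYPE('m) TYPE('h) TYPE('v) M :: _ \<Rightarrow> 'r) \<in> subset_sum_set (tile_vector ` T)"
      unfolding subset_sum_set_def mem_Collect_eq
      by (intro exI[of _ gs] exI[of _ "map (\<lambda>g. tile_vector (\<tau> g)) gs"]) (use gs D in auto)
  qed
qed

text \<open>The three groups of labels are placed at three different positions and cannot cancel
  each other.\<close>

lemma tile_vector_neq_0:
  fixes t :: "('m::countable, 'h::countable, 'v::countable) tile"
  assumes "t \<noteq> blank"
  shows "(tile_vector t :: _ \<Rightarrow> 'r::ring_1) \<noteq> (\<lambda>_. 0)"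
proof
  assume 0: "(tile_vector t :: _ \<Rightarrow> 'r) = (\<lambda>_. 0)"
  have "x \<notin> to_nat ` out_labels t" "x \<notin> to_nat ` west_labels t" "x \<notin> to_nat ` south_labels t" for x
    using fun_cong[OF 0, of "((0, 0), x)"] fun_cong[OF 0, of "((-1, 0), x)"] fun_cong[OF 0, of "((0, -1), x)"]
    unfolding tile_vector_def by auto
  then have "out_labels t = {}" "west_labels t = {}" "south_labels t = {}" by blast+
  then show False using assms
    unfolding out_labels_def west_labels_def south_labels_def by (cases t) auto
qed

lemma tile_vector_in_free_mod:
  assumes "\<And>l. l \<in> out_labels t \<union> west_labels t \<union> south_labels t \<Longrightarrow> to_nat l < k"
  shows "(tile_vector t :: _ \<Rightarrow> 'r::ring_1) \<in> free_mod k"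
proof -
  have small: "x < k" if "x \<in> to_nat ` out_labels t \<or> x \<in> to_nat ` west_labels t \<or> x \<in> to_nat ` south_labels t" for x
    using that assms by blast
  have zero: "(tile_vector t :: _ \<Rightarrow> 'r) (g, x) = 0"
    if "g \<notin> {(0, 0), (-1, 0), (0, -1)} \<or> k \<le> x" for g x
  proof (cases "k \<le> x")
    case True
    then have "x \<notin> to_nat ` out_labels t" "x \<notin> to_nat ` west_labels t" "x \<notin> to_nat ` south_labels t"
      using small[of x] by auto
    then show ?thesis unfolding tile_vector_def by (cases g) simp
  qed (use that in \<open>cases g; auto simp: tile_vector_def\<close>)
  have "{p. (tile_vector t :: _ \<Rightarrow> 'r) p \<noteq> 0} \<subseteq> {(0, 0), (-1, 0), (0, -1)} \<times> {..<k}"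
  proof
    fix p assume "p \<in> {p. (tile_vector t :: _ \<Rightarrow> 'r) p \<noteq> 0}"
    then have "\<not> (fst p \<notin> {(0, 0), (-1, 0), (0, -1)} \<or> k \<le> snd p)"
      using zero[of "fst p" "snd p"] by auto
    then show "p \<in> {(0, 0), (-1, 0), (0, -1)} \<times> {..<k}"
      by (simp add: mem_Times_iff)
  qed
  from finite_subset[OF this] show ?thesis
    unfolding free_mod_def using zero by simp
qed

section \<open>Tiles for the runs of a machine\<close>

datatype mark = Origin | Input
text \<open>Row labels, on west and east edges, tell a whole row what it does: lie before or after
  the input mark, execute address \<open>pc\<close> with branch \<open>z\<close>, or close the
  diagram. Column labels, on south and north edges, hold the state; \<open>Last\<close> marks the
  easternmost column.\<close>

datatype row_label = Before | After | Final | Row nat bool | Carry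
datatype column_label = Cell | Last | Reg nat | Pc nat

instance mark :: countable by countable_datatype
instance row_label :: countable by countable_datatype
instance column_label :: countable by countable_datatype

definition cell :: "nat set \<Rightarrow> bool \<Rightarrow> column_label set" where
  "cell A l = insert Cell (Reg ` A \<union> (if l then {Last} else {}))"

definition row :: "nat \<Rightarrow> bool \<Rightarrow> bool \<Rightarrow> row_label set" where
  "row pc z c = insert (Row pc z) (if c then {Carry} else {})"

lemma mem_cell [simp]:
  "Cell \<in> cell A l" "Last \<in> cell A l \<longleftrightarrow> l" "Reg r \<in> cell A l \<longleftrightarrow> r \<in> A" "Pc pc \<notin> cell A l"
  by (auto simp: cell_def)

lemma mem_row [simp]:
  "Before \<notin> row pc z c" "After \<notin> row pc z c" "Final \<notin> row pc z c"
  "Row pc' z' \<in> row pc z c \<longleftrightarrow> pc' = pc \<and> z' = z" "Carry \<in> row pc z c \<longleftrightarrow> c"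
  by (auto simp: row_def)

lemma cell_eq_iff: "cell A l = cell A' l' \<longleftrightarrow> A = A' \<and> l = l'"
proof
  assume eq: "cell A l = cell A' l'"
  have "(r \<in> A) = (r \<in> A')" for r using eq mem_cell(3) by metis
  moreover have "l = l'" using eq mem_cell(2) by metis
  ultimately show "A = A' \<and> l = l'" by blast
qed simp

lemma insert_Pc_cell_eq_iff:
  "insert (Pc pc) (cell A l) = insert (Pc pc') (cell A' l') \<longleftrightarrow> pc = pc' \<and> A = A' \<and> l = l'"
proof
  assume eq: "insert (Pc pc) (cell A l) = insert (Pc pc') (cell A' l')"
  then have "Pc pc \<in> insert (Pc pc') (cell A' l')" by blast
  then have pc: "pc = pc'" by simp
  have "Pc pc \<notin> cell A l" "Pc pc \<notin> cell A' l'" by simp_all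
  then have "cell A l = cell A' l'" using eq pc by (metis insert_ident)
  then show "pc = pc' \<and> A = A' \<and> l = l'" using pc by (simp add: cell_eq_iff)
qed simp

section \<open>Local rules for one machine step\<close>

text \<open>The arguments of \<open>update\<close>: whether the row takes the zero branch, the registers with the value
  of this column before and after, and the carries across the west and the east edge. A carry
  moves the unary mark of a register eastwards for \<open>INC\<close> and westwards for \<open>DEC\<close>.\<close>

fun update :: "instr \<Rightarrow> bool \<Rightarrow> nat set \<Rightarrow> bool \<Rightarrow> bool \<Rightarrow> nat set \<Rightarrow> bool" where
  "update (INC r j) z A w e B \<longleftrightarrow> e = (r \<in> A) \<and> B = (if w then insert r (A - {r}) else A - {r})"
| "update (DEC r j k) z A w e B \<longleftrightarrow>
     (if z then \<not> w \<and> \<not> e \<and> B = A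
      else w = (r \<in> A) \<and> B = (if e then insert r (A - {r}) else A - {r}))"

fun target :: "instr \<Rightarrow> bool \<Rightarrow> nat" where
  "target (INC r j) z = j"
| "target (DEC r j k) z = (if z then k else j)"

text \<open>That a register is 0 shows only in column 0, so the zero branch is checked there. The
  opposite mistake, a decrement of 0, would need a carry across the west edge of column 0, which
  \<open>step_left\<close> does not provide.\<close>

fun zero_ok :: "instr \<Rightarrow> bool \<Rightarrow> nat set \<Rightarrow> bool" where
  "zero_ok (INC r j) z A \<longleftrightarrow> \<not> z"
| "zero_ok (DEC r j k) z A \<longleftrightarrow> (z \<longrightarrow> r \<in> A)"

fun is_zero_branch :: "instr \<Rightarrow> (nat \<Rightarrow> nat) \<Rightarrow> bool" where
  "is_zero_branch (INC r j) v = False"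
| "is_zero_branch (DEC r j k) v = (v r = 0)"

text \<open>Whether the mark of the register crosses the edge between columns \<open>i\<close> and
  \<open>Suc i\<close>, eastwards for \<open>INC\<close> and westwards for
  \<open>DEC\<close>.\<close>

fun carry :: "instr \<Rightarrow> (nat \<Rightarrow> nat) \<Rightarrow> nat \<Rightarrow> bool" where
  "carry (INC r j) v i = (v r = i)"
| "carry (DEC r j k) v i = (v r = Suc i)"

text \<open>\<open>c i\<close> is the carry across the east edge of column \<open>i\<close>. For
  \<open>INC\<close> the rules force \<open>c i = (v r = i)\<close>, so \<open>\<not> c N\<close>
  excludes an overflow of the rectangle. For \<open>DEC\<close> on the nonzero branch, the missing
  west carry of column 0 yields \<open>v r \<noteq> 0\<close>.\<close>

lemma exec_if_update:
  assumes up: "\<And>i. i \<le> N \<Longrightarrow> update ins z {r. r < R \<and> v r = i} (0 < i \<and> c (i - 1)) (c i) (B i)"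
    and "zero_ok ins z {r. r < R \<and> v r = 0}" "\<not> c N" "\<forall>r<R. v r \<le> N" "instr_reg ins < R"
    and ex: "exec ins v = (pc', v')"
  shows "pc' = target ins z" "\<forall>r<R. v' r \<le> N" "\<And>i. i \<le> N \<Longrightarrow> B i = {r. r < R \<and> v' r = i}"
proof -
  have *: "pc' = target ins z \<and> (\<forall>r<R. v' r \<le> N) \<and> (\<forall>i\<le>N. B i = {r. r < R \<and> v' r = i})"
  proof (cases ins)
    case (INC r j)
    have r: "r < R" using assms INC by simp
    have v': "pc' = j" "v' = v(r := Suc (v r))" using ex INC by auto
    have c: "c i = (v r = i)" if "i \<le> N" for i using up[OF that] INC r by simp
    then have lt: "v r < N" using assms(3,4) r by (metis order_refl le_neq_implies_less)
    have "B i = {r. r < R \<and> v' r = i}" if "i \<le> N" for i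
    proof -
      have "(0 < i \<and> c (i - 1)) = (i = Suc (v r))" using c[of "i - 1"] that by auto
      then show ?thesis using up[OF that] INC r v'(2) by (auto split: if_splits)
    qed
    then show ?thesis using lt assms(4) INC v' by auto
  next
    case (DEC r j k)
    have r: "r < R" using assms DEC by simp
    show ?thesis
    proof (cases z)
      case True
      then have "v r = 0" using assms(2) DEC by simp
      then show ?thesis using ex up True DEC assms(4) by auto
    next
      case False
      have c: "(0 < i \<and> c (i - 1)) = (v r = i)" if "i \<le> N" for i using up[OF that] DEC False r by simp
      then have v': "v r \<noteq> 0" "pc' = j" "v' = v(r := v r - 1)" using c[of 0] ex DEC by auto
      have "B i = {r. r < R \<and> v' r = i}" if "i \<le> N" for i
      proof -
        have "c i = (v r = Suc i)"
        proof (cases "i = N")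
          case True
          then show ?thesis using assms(3,4) r by auto
        next
          case False
          then show ?thesis using c[of "Suc i"] that by simp
        qed
        moreover have "B i = (if c i then insert r ({r. r < R \<and> v r = i} - {r}) else {r. r < R \<and> v r = i} - {r})"
          using up[OF that] DEC False by simp
        moreover have "(v r - 1 = i) = (v r = Suc i)" using v'(1) by linarith
        ultimately show ?thesis using r unfolding v'(3) by (cases "v r = Suc i") auto
      qed
      moreover have "\<forall>r<R. v' r \<le> N" using assms(4) v'(3) by (auto intro: le_trans[OF diff_le_self])
      ultimately show ?thesis using False DEC v' by auto
    qed
  qed
  then show "pc' = target ins z" "\<forall>r<R. v' r \<le> N" "\<And>i. i \<le> N \<Longrightarrow> B i = {r. r < R \<and> v' r = i}" by auto
qed

text \<open>The bounds on \<open>v\<close> and \<open>v'\<close> imply that no mark has to cross the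
  east edge of column \<open>N\<close>, so cutting the carry off there loses nothing.\<close>

lemma update_exec:
  assumes "exec ins v = (pc', v')" "instr_reg ins < R" "i \<le> N" "\<forall>r<R. v r \<le> N" "\<forall>r<R. v' r \<le> N"
  shows "update ins (is_zero_branch ins v) {r. r < R \<and> v r = i} (0 < i \<and> carry ins v (i - 1))
     (i < N \<and> carry ins v i) {r. r < R \<and> v' r = i}"
proof (cases ins)
  case (INC r j)
  have v': "v' = v(r := Suc (v r))" and r: "r < R" using assms INC by auto
  have "v r < N" using assms(5) v' r by auto
  then have "(i < N \<and> v r = i) = (v r = i)" by auto
  moreover have "(0 < i \<and> v r = i - 1) = (i = Suc (v r))" by auto
  ultimately show ?thesis using INC r v' by auto
next
  case (DEC r j k)
  have r: "r < R" using assms DEC by auto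
  show ?thesis
  proof (cases "v r = 0")
    case True
    then show ?thesis using assms(1) DEC by auto
  next
    case False
    have v': "v' = v(r := v r - 1)" using assms(1) DEC False by auto
    have "(i < N \<and> v r = Suc i) = (v r = Suc i)" using assms(4) r by auto
    moreover have "(0 < i \<and> v r = Suc (i - 1)) = (v r = i)" using False by auto
    ultimately show ?thesis using DEC r v' False by auto
  qed
qed

text \<open>The column is \<open>Suc n\<close>, so that the two marks differ even for
  \<open>n = 0\<close>. The machine accordingly starts with \<open>Suc n\<close> in register
  0.\<close>

definition input_marks :: "nat \<Rightarrow> int \<times> int \<Rightarrow> mark set" where
  "input_marks n g = (if g = (0, 0) then {Origin} else {}) \<union> (if g = (int (Suc n), 0) then {Input} else {})"

definition initial :: "nat \<Rightarrow> nat \<Rightarrow> nat" where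
  "initial n = (\<lambda>_. 0)(0 := Suc n)"

text \<open>\<open>acc\<close> lies outside the program, so at an address inside it the tiles of the
  closing row cannot replace a step.\<close>

locale machine =
  fixes P :: "instr list" and R acc :: nat
  assumes regs: "\<And>i. i \<in> set P \<Longrightarrow> instr_reg i < R" and R: "0 < R" and acc: "length P \<le> acc"
begin

text \<open>A tiling of a rectangle is a space-time diagram: column \<open>i\<close> of the horizontal line above
  row \<open>t\<close> lists the registers with value \<open>i\<close> after \<open>t\<close> steps, and column \<open>0\<close> also carries the
  program counter.\<close>

inductive_set tiles :: "(mark, row_label, column_label) tile set" where
  origin: "Tile {Origin} {} {Before} {} (insert (Pc 0) (cell {r. r < R \<and> 0 < r} False)) \<in> tiles"
| before: "Tile {} {Before} {Before} {} (cell {} False) \<in> tiles"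
| input: "Tile {Input} {Before} {After} {} (cell {0} False) \<in> tiles"
| after: "Tile {} {After} {After} {} (cell {} False) \<in> tiles"
| first_end: "Tile {} {After} {} {} (cell {} True) \<in> tiles"
| step_left: "\<lbrakk>pc < length P; A \<subseteq> {..<R}; B \<subseteq> {..<R}; update (P ! pc) z A False e B; zero_ok (P ! pc) z A\<rbrakk> \<Longrightarrow>
    Tile {} {} (row pc z e) (insert (Pc pc) (cell A False))
      (insert (Pc (target (P ! pc) z)) (cell B False)) \<in> tiles"
| step_mid: "\<lbrakk>pc < length P; A \<subseteq> {..<R}; B \<subseteq> {..<R}; update (P ! pc) z A w e B\<rbrakk> \<Longrightarrow>
    Tile {} (row pc z w) (row pc z e) (cell A False) (cell B False) \<in> tiles"
| step_end: "\<lbrakk>pc < length P; A \<subseteq> {..<R}; B \<subseteq> {..<R}; update (P ! pc) z A w False B\<rbrakk> \<Longrightarrow>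
    Tile {} (row pc z w) {} (cell A True) (cell B True) \<in> tiles"
| final_left: "A \<subseteq> {..<R} \<Longrightarrow> Tile {} {} {Final} (insert (Pc acc) (cell A False)) {} \<in> tiles"
| final_mid: "A \<subseteq> {..<R} \<Longrightarrow> Tile {} {Final} {Final} (cell A False) {} \<in> tiles"
| final_end: "A \<subseteq> {..<R} \<Longrightarrow> Tile {} {Final} {} (cell A True) {} \<in> tiles"

lemma blank_notin_tiles: "blank \<notin> tiles"
  by (auto elim!: tiles.cases simp: row_def)

text \<open>Both finiteness of the tile set and of the label sets, hence of the rank, are derived
  from this common finite alphabet.\<close>

lemma tile_labels:
  obtains H V where "finite H" "finite V"
    "\<And>t. t \<in> tiles \<Longrightarrow> east t \<subseteq> H \<and> west t \<subseteq> H \<and> south t \<subseteq> V \<and> north t \<subseteq> V"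
proof -
  define H where "H = {Before, After, Final, Carry} \<union> (\<lambda>(pc, z). Row pc z) ` ({..<length P} \<times> UNIV)"
  define V where "V = {Cell, Last, Pc 0, Pc acc} \<union> Reg ` {..<R} \<union> Pc ` {..<length P}
     \<union> (\<lambda>(pc, z). Pc (target (P ! pc) z)) ` ({..<length P} \<times> UNIV)"
  have row: "row pc z c \<subseteq> H" if "pc < length P" for pc z c
    using that unfolding row_def H_def by auto
  have cell: "cell A l \<subseteq> V" if "A \<subseteq> {..<R}" for A l
    using that unfolding cell_def V_def by auto
  have Pc: "Pc 0 \<in> V" "Pc acc \<in> V" "pc < length P \<Longrightarrow> Pc pc \<in> V" "pc < length P \<Longrightarrow> Pc (target (P ! pc) z) \<in> V" for pc z
    unfolding V_def by auto
  have H: "Before \<in> H" "After \<in> H" "Final \<in> H" unfolding H_def by auto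
  have sets: "{r. r < R \<and> 0 < r} \<subseteq> {..<R}" "{} \<subseteq> {..<R}" "{0} \<subseteq> {..<R}" using R by auto
  show ?thesis
  proof (rule that)
    show "finite H" "finite V" unfolding H_def V_def by auto
    show "east t \<subseteq> H \<and> west t \<subseteq> H \<and> south t \<subseteq> V \<and> north t \<subseteq> V" if "t \<in> tiles" for t
      using that by cases (simp_all add: row cell Pc H cell[OF sets(1)] cell[OF sets(2)] cell[OF sets(3)])
  qed
qed

lemma finite_tiles: "finite tiles"
proof -
  obtain H V where HV: "finite H" "finite V"
    "\<And>t. t \<in> tiles \<Longrightarrow> east t \<subseteq> H \<and> west t \<subseteq> H \<and> south t \<subseteq> V \<and> north t \<subseteq> V"
    using tile_labels by metis
  let ?T = "(\<lambda>(m, w, e, s, n). Tile m w e s n) ` (Pow {Origin, Input} \<times> Pow H \<times> Pow H \<times> Pow V \<times> Pow V)"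
  have "t \<in> ?T" if "t \<in> tiles" for t
  proof -
    have "marks t \<subseteq> {Origin, Input}" using mark.exhaust by auto
    then show ?thesis using HV(3)[OF that]
      by (intro image_eqI[of _ _ "(marks t, west t, east t, south t, north t)"]) auto
  qed
  moreover have "finite ?T" using HV by auto
  ultimately show ?thesis by (meson finite_subset subsetI)
qed

lemma finite_labels:
  assumes "t \<in> tiles"
  shows "finite (out_labels t \<union> west_labels t \<union> south_labels t)"
proof -
  obtain H V where HV: "finite H" "finite V"
    "\<And>t. t \<in> tiles \<Longrightarrow> east t \<subseteq> H \<and> west t \<subseteq> H \<and> south t \<subseteq> V \<and> north t \<subseteq> V"
    using tile_labels by metis
  have "marks t \<subseteq> {Origin, Input}" using mark.exhaust by auto
  then have "finite (marks t)" "finite (east t)" "finite (west t)" "finite (south t)" "finite (north t)"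
    using HV(1,2) HV(3)[OF assms] by (auto intro: finite_subset)
  then show ?thesis unfolding out_labels_def west_labels_def south_labels_def by auto
qed

text \<open>This and the following lemmas make the diagram deterministic: a single mark or label on
  a west or south edge leaves only the stated tiles.\<close>

lemma tile_if_Origin:
  "t \<in> insert blank tiles \<Longrightarrow> Origin \<in> marks t \<Longrightarrow>
   t = Tile {Origin} {} {Before} {} (insert (Pc 0) (cell {r. r < R \<and> 0 < r} False))"
  by (auto elim!: tiles.cases)

lemma tile_if_Before:
  "t \<in> insert blank tiles \<Longrightarrow> Before \<in> west t \<Longrightarrow>
   t = Tile {} {Before} {Before} {} (cell {} False) \<or> t = Tile {Input} {Before} {After} {} (cell {0} False)"
  by (auto elim!: tiles.cases)

lemma tile_if_After:
  "t \<in> insert blank tiles \<Longrightarrow> After \<in> west t \<Longrightarrow>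
   t = Tile {} {After} {After} {} (cell {} False) \<or> t = Tile {} {After} {} {} (cell {} True)"
  by (auto elim!: tiles.cases)

text \<open>No tile fits above an address that is neither in the program nor \<open>acc\<close>;
  this is how rejection prevents a tiling.\<close>

lemma Pc_bound: "t \<in> insert blank tiles \<Longrightarrow> Pc pc \<in> south t \<Longrightarrow> pc < length P \<or> pc = acc"
  by (auto elim!: tiles.cases)

lemma tile_if_Pc:
  assumes "t \<in> insert blank tiles" "Pc pc \<in> south t" "pc < length P"
  obtains A B z e where "t = Tile {} {} (row pc z e) (insert (Pc pc) (cell A False))
      (insert (Pc (target (P ! pc) z)) (cell B False))"
    "update (P ! pc) z A False e B" "zero_ok (P ! pc) z A"
proof -
  have "t \<in> tiles" using assms by auto
  then show thesis by cases (use that assms acc in auto)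
qed

lemma tile_if_Row:
  assumes "t \<in> insert blank tiles" "Row pc z \<in> west t"
  obtains A B w e l where "update (P ! pc) z A w e B" "l \<longrightarrow> \<not> e"
    "t = Tile {} (row pc z w) (if l then {} else row pc z e) (cell A l) (cell B l)"
proof -
  have "t \<in> tiles" using assms by auto
  then show thesis
  proof cases
    case (step_mid pc' A B z' w e)
    then show ?thesis using that[of A w e B False] assms by auto
  next
    case (step_end pc' A B z' w)
    then show ?thesis using that[of A w False B True] assms by auto
  qed (use assms in auto)
qed

section \<open>Every tiling follows the run\<close>

definition column_labels :: "nat \<Rightarrow> (nat \<Rightarrow> nat) \<Rightarrow> nat \<Rightarrow> nat \<Rightarrow> column_label set" where
  "column_labels pc v N i =
     (if i = 0 then insert (Pc pc) else id) (cell {r. r < R \<and> v r = i} (i = N))"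

lemma initial_registers:
  "{r. r < R \<and> initial n r = i} =
     (if i = 0 then {r. r < R \<and> 0 < r} else if i = Suc n then {0} else {})"
  using R unfolding initial_def by auto

context
  fixes n \<tau>
  assumes \<tau>: "tiling tiles (input_marks n) \<tau>"
begin

lemma tiling_facts:
  "finite {g. \<tau> g \<noteq> blank}" "\<tau> g \<in> insert blank tiles" "marks (\<tau> g) = input_marks n g"
  "west (\<tau> (int (Suc i), b)) = east (\<tau> (int i, b))" "south (\<tau> (a, int (Suc j))) = north (\<tau> (a, int j))"
  using \<tau> unfolding tiling_def by (auto simp: add.commute) (cases g; simp)+

text \<open>From the corner, \<open>Before\<close> spreads east until the position of the
  \<open>Input\<close> mark, where the marked tile is the only choice. Beyond it
  \<open>after\<close> tiles cannot continue forever because the support is finite; the column of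
  the end tile becomes the width \<open>N\<close>.\<close>

lemma first_row:
  obtains N where "0 < N" "\<And>r. initial n r \<le> N"
    "\<And>i. i \<le> N \<Longrightarrow> north (\<tau> (int i, 0)) = column_labels 0 (initial n) N i"
proof -
  have before: "\<tau> (int i, 0) = (if i = 0 then Tile {Origin} {} {Before} {} (insert (Pc 0) (cell {r. r < R \<and> 0 < r} False))
      else Tile {} {Before} {Before} {} (cell {} False))" if "i \<le> n" for i
    using that
  proof (induction i)
    case 0
    have "Origin \<in> marks (\<tau> (int 0, 0))" unfolding tiling_facts(3) input_marks_def by simp
    then show ?case using tile_if_Origin[OF tiling_facts(2)] by simp
  next
    case (Suc i)
    then have "Before \<in> west (\<tau> (int (Suc i), 0))" unfolding tiling_facts(4) by auto
    moreover have "marks (\<tau> (int (Suc i), 0)) = {}"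
      using Suc.prems unfolding tiling_facts(3) input_marks_def by auto
    ultimately show ?case using tile_if_Before[OF tiling_facts(2)] by fastforce
  qed
  have "Before \<in> west (\<tau> (int (Suc n), 0))" using before[of n] unfolding tiling_facts(4) by auto
  note tile_if_Before[OF tiling_facts(2) this]
  moreover have "marks (\<tau> (int (Suc n), 0)) \<noteq> {}" unfolding tiling_facts(3) input_marks_def by simp
  ultimately have input: "\<tau> (int (Suc n), 0) = Tile {Input} {Before} {After} {} (cell {0} False)"
    by (elim disjE) simp_all
  let ?after = "Tile {} {After} {After} {} (cell {} False) :: (mark, row_label, column_label) tile"
  have "\<exists>d. \<tau> (int (n + 2 + d), 0) \<noteq> ?after"
  proof (rule ccontr)
    assume "\<not> ?thesis"
    then have "range (\<lambda>d. (int (n + 2 + d), 0)) \<subseteq> {g. \<tau> g \<noteq> blank}" by auto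
    moreover have "inj (\<lambda>d. (int (n + 2 + d), 0 :: int))" by (auto simp: inj_def)
    ultimately have "finite (UNIV :: nat set)"
      using tiling_facts(1) finite_subset finite_imageD by blast
    then show False by simp
  qed
  define d where "d = (LEAST d. \<tau> (int (n + 2 + d), 0) \<noteq> ?after)"
  have d: "\<tau> (int (n + 2 + d), 0) \<noteq> ?after"
    unfolding d_def by (rule LeastI_ex) fact
  have after: "\<tau> (int (n + 2 + d'), 0) = ?after" if "d' < d" for d'
    using that not_less_Least unfolding d_def by blast
  have "After \<in> east (\<tau> (int (n + 1 + d), 0))"
  proof (cases d)
    case 0
    then show ?thesis using input by simp
  next
    case (Suc d')
    then show ?thesis using after[of d'] by simp
  qed
  then have "After \<in> west (\<tau> (int (n + 2 + d), 0))"
    using tiling_facts(4)[of "n + 1 + d" 0] by simp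
  then have last: "\<tau> (int (n + 2 + d), 0) = Tile {} {After} {} {} (cell {} True)"
    using tile_if_After[OF tiling_facts(2)] d by blast
  show thesis
  proof (rule that[of "n + 2 + d"])
    show "initial n r \<le> n + 2 + d" for r unfolding initial_def by simp
    fix i assume i: "i \<le> n + 2 + d"
    consider "i \<le> n" | "i = Suc n" | d' where "i = n + 2 + d'" "d' < d" | "i = n + 2 + d"
    proof -
      have "i \<le> n \<or> i = Suc n \<or> i = n + 2 + (i - (n + 2)) \<and> i - (n + 2) < d \<or> i = n + 2 + d"
        using i by linarith
      then show thesis using that by blast
    qed
    then show "north (\<tau> (int i, 0)) = column_labels 0 (initial n) (n + 2 + d) i"
    proof cases
      case 1
      then show ?thesis using before[OF 1] unfolding column_labels_def initial_registers by simp
    next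
      case 2
      then show ?thesis using input unfolding column_labels_def initial_registers by simp
    next
      case 3
      then show ?thesis using after[OF 3(2)] unfolding column_labels_def initial_registers by simp
    next
      case 4
      then show ?thesis using last unfolding column_labels_def initial_registers by simp
    qed
  qed simp
qed

text \<open>The program counter in column 0 forces a \<open>step_left\<close> tile. Its
  \<open>Row\<close> label spreads eastwards, so all columns agree on instruction and branch, and
  \<open>Last\<close> on the south edge of column \<open>N\<close> selects an end tile there and
  nowhere earlier.\<close>

lemma next_row:
  assumes N: "0 < N" "\<forall>r<R. v r \<le> N" and pc: "pc < length P"
    and below: "\<And>i. i \<le> N \<Longrightarrow> north (\<tau> (int i, int j)) = column_labels pc v N i"
    and ex: "exec (P ! pc) v = (pc', v')"
  shows "(\<forall>r<R. v' r \<le> N) \<and> (\<forall>i\<le>N. north (\<tau> (int i, int (Suc j))) = column_labels pc' v' N i)"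
proof -
  let ?t = "\<lambda>i. \<tau> (int i, int (Suc j))"
  let ?A = "\<lambda>i. {r. r < R \<and> v r = i}"
  define c where "c i = (Carry \<in> east (?t i))" for i
  have south: "south (?t i) = column_labels pc v N i" if "i \<le> N" for i
    using below[OF that] tiling_facts(5) by simp
  have "Pc pc \<in> south (?t 0)" using south[of 0] unfolding column_labels_def by simp
  then obtain A B0 z e where t0: "?t 0 = Tile {} {} (row pc z e) (insert (Pc pc) (cell A False))
      (insert (Pc (target (P ! pc) z)) (cell B0 False))"
    "update (P ! pc) z A False e B0" "zero_ok (P ! pc) z A"
    using tile_if_Pc[OF tiling_facts(2) _ pc] by metis
  have "insert (Pc pc) (cell A False) = insert (Pc pc) (cell (?A 0) False)"
    using south[of 0] t0(1) N(1) unfolding column_labels_def by simp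
  then have A: "A = ?A 0" unfolding insert_Pc_cell_eq_iff by simp
  have e: "e = c 0" unfolding c_def t0(1) by simp
  have "(i < N \<longrightarrow> east (?t i) = row pc z (c i)) \<and> (i = N \<longrightarrow> \<not> c i) \<and>
     (\<exists>B. update (P ! pc) z (?A i) (0 < i \<and> c (i - 1)) (c i) B \<and>
       north (?t i) = (if i = 0 then insert (Pc (target (P ! pc) z)) else id) (cell B (i = N)))"
    if "i \<le> N" for i
    using that
  proof (induction i)
    case 0
    show ?case using t0 A e N(1) by (auto intro!: exI[of _ B0])
  next
    case (Suc i)
    then have west: "west (?t (Suc i)) = row pc z (c i)" unfolding tiling_facts(4) by simp
    then have "Row pc z \<in> west (?t (Suc i))" by simp
    then obtain A' B' w e' l where t: "update (P ! pc) z A' w e' B'" "l \<longrightarrow> \<not> e'"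
      "?t (Suc i) = Tile {} (row pc z w) (if l then {} else row pc z e') (cell A' l) (cell B' l)"
      using tile_if_Row[OF tiling_facts(2)] by metis
    have "cell A' l = cell (?A (Suc i)) (Suc i = N)"
      using south[OF Suc.prems] t(3) unfolding column_labels_def by simp
    then have A': "A' = ?A (Suc i)" "l = (Suc i = N)" unfolding cell_eq_iff by simp_all
    have "Carry \<in> west (?t (Suc i)) \<longleftrightarrow> c i" using west by simp
    then have w: "w = c i" using t(3) by simp
    have e': "e' = c (Suc i)" using t(2) unfolding c_def t(3) by simp
    show ?case using t A' w e' Suc.prems by (auto intro!: exI[of _ B'])
  qed
  note columns = this
  have cN: "\<not> c N" using columns[of N] by simp
  have "\<forall>i\<in>{..N}. \<exists>B. update (P ! pc) z (?A i) (0 < i \<and> c (i - 1)) (c i) B \<and>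
     north (?t i) = (if i = 0 then insert (Pc (target (P ! pc) z)) else id) (cell B (i = N))"
    using columns by simp
  from bchoice[OF this] obtain B where
    "\<forall>i\<in>{..N}. update (P ! pc) z (?A i) (0 < i \<and> c (i - 1)) (c i) (B i) \<and>
     north (?t i) = (if i = 0 then insert (Pc (target (P ! pc) z)) else id) (cell (B i) (i = N))" ..
  then have B: "\<And>i. i \<le> N \<Longrightarrow> update (P ! pc) z (?A i) (0 < i \<and> c (i - 1)) (c i) (B i)"
    "\<And>i. i \<le> N \<Longrightarrow> north (?t i) = (if i = 0 then insert (Pc (target (P ! pc) z)) else id) (cell (B i) (i = N))"
    by simp_all
  have reg: "instr_reg (P ! pc) < R" using regs pc by simp
  have upd: "pc' = target (P ! pc) z" "\<forall>r<R. v' r \<le> N" "\<And>i. i \<le> N \<Longrightarrow> B i = {r. r < R \<and> v' r = i}"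
    using exec_if_update[where c = c and B = B, OF _ t0(3)[unfolded A] cN N(2) reg ex] B(1) by blast+
  show ?thesis
    using upd(2,3) B(2) unfolding column_labels_def upd(1) by simp
qed

lemma tiling_sound:
  assumes "(step P)\<^sup>*\<^sup>* (0, initial n) (pc, v)"
  shows "pc < length P \<or> pc = acc"
proof -
  obtain N where N: "0 < N" "\<And>r. initial n r \<le> N"
    "\<And>i. i \<le> N \<Longrightarrow> north (\<tau> (int i, 0)) = column_labels 0 (initial n) N i"
    using first_row by blast
  have "\<exists>j. (\<forall>r<R. v r \<le> N) \<and> (\<forall>i\<le>N. north (\<tau> (int i, int j)) = column_labels pc v N i)"
    using assms
  proof (induction rule: rtranclp_induct2)
    case refl
    show ?case using N by (intro exI[of _ 0]) auto
  next
    case (step pc v pc' v')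
    then obtain j where j: "\<forall>r<R. v r \<le> N" "\<And>i. i \<le> N \<Longrightarrow> north (\<tau> (int i, int j)) = column_labels pc v N i"
      by blast
    have "pc < length P" "exec (P ! pc) v = (pc', v')" using step.hyps(2) unfolding step_def by auto
    from next_row[OF N(1) j(1) this(1) j(2) this(2)] show ?case by blast
  qed
  then obtain j where "north (\<tau> (int 0, int j)) = column_labels pc v N 0" by blast
  then have "Pc pc \<in> south (\<tau> (int 0, int (Suc j)))"
    unfolding tiling_facts(5) column_labels_def by simp
  then show ?thesis using Pc_bound[OF tiling_facts(2)] by blast
qed

end

section \<open>An accepting run yields a tiling\<close>

lemma tiling_complete:
  assumes "(step P)\<^sup>*\<^sup>* (0, initial n) (acc, v)"
  shows "\<exists>\<tau>. tiling tiles (input_marks n) \<tau>"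
proof -
  obtain T f where f: "f 0 = (0, initial n)" "f T = (acc, v)" "\<And>t. t < T \<Longrightarrow> step P (f t) (f (Suc t))"
    using assms unfolding rtranclp_power relpowp_fun_conv by auto
  define pc where "pc t = fst (f t)" for t
  define w where "w t = snd (f t)" for t
  have f': "pc 0 = 0" "w 0 = initial n" "pc T = acc" unfolding pc_def w_def f by simp_all
  have stp: "pc t < length P" "exec (P ! pc t) (w t) = (pc (Suc t), w (Suc t))" if "t < T" for t
    using f(3)[OF that] unfolding step_def pc_def w_def by auto
  \<comment> \<open>Wide enough for all register values of the run and for an end tile to the right
    of the input mark in column \<open>n + 1\<close>.\<close>
  define N where "N = Max (insert (n + 2) ((\<lambda>(t, r). w t r) ` ({..T} \<times> {..<R})))"
  have N_ge: "x \<le> N" if "x \<in> insert (n + 2) ((\<lambda>(t, r). w t r) ` ({..T} \<times> {..<R}))" for x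
    unfolding N_def by (rule Max_ge[OF _ that]) auto
  have N: "n + 2 \<le> N" "\<And>t. t \<le> T \<Longrightarrow> \<forall>r<R. w t r \<le> N"
    by (rule N_ge, simp) (auto intro!: N_ge intro: rev_image_eqI)
  define ins where "ins t = P ! pc t" for t
  define z where "z t = is_zero_branch (ins t) (w t)" for t
  \<comment> \<open>\<open>H i j\<close> and \<open>V i j\<close> are the east and north edges of
    the tile at \<open>(i, j)\<close>. West and south edges are taken from the neighbours, so
    matching inside the rectangle is automatic. Row 0 holds the initial state, row
    \<open>Suc t\<close> performs step \<open>t\<close>, row \<open>Suc T\<close> closes the
    diagram.\<close>
  define H where "H i j = (if i < N then
      if j = 0 then (if i \<le> n then {Before} else {After})
      else if j \<le> T then row (pc (j - 1)) (z (j - 1)) (carry (ins (j - 1)) (w (j - 1)) i)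
      else {Final} else {})" for i j :: nat
  define V where "V i j = (if j \<le> T then column_labels (pc j) (w j) N i else {})" for i j :: nat
  define tile where "tile i j = Tile (input_marks n (int i, int j)) (if i = 0 then {} else H (i - 1) j) (H i j)
      (if j = 0 then {} else V i (j - 1)) (V i j)" for i j
  have tile: "tile i j \<in> tiles" if i: "i \<le> N" and j: "j \<le> Suc T" for i j
  proof -
    have lt: "i - Suc 0 < N" using i N(1) by linarith
    consider "j = 0" | t where "j = Suc t" "t < T" | "j = Suc T"
      using j by (metis le_SucE not0_implies_Suc Suc_le_eq)
    then show ?thesis
    proof cases
      case 1
      have V: "V i j = column_labels 0 (initial n) N i" unfolding V_def 1 f' by simp
      consider "i = 0" | "0 < i" "i \<le> n" | "i = Suc n" | "n + 2 \<le> i" "i < N" | "n + 2 \<le> i" "i = N"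
        using i by linarith
      then show ?thesis
      proof cases
        case a: 1
        have "tile i j = Tile {Origin} {} {Before} {} (insert (Pc 0) (cell {r. r < R \<and> 0 < r} False))"
          unfolding tile_def V using N(1) a 1 by (simp add: H_def column_labels_def initial_registers input_marks_def)
        then show ?thesis using tiles.origin by simp
      next
        case a: 2
        have "tile i j = Tile {} {Before} {Before} {} (cell {} False)"
          unfolding tile_def V using N(1) a 1 by (simp add: H_def column_labels_def initial_registers input_marks_def)
        then show ?thesis using tiles.before by simp
      next
        case a: 3
        have "tile i j = Tile {Input} {Before} {After} {} (cell {0} False)"
          unfolding tile_def V using N(1) a 1 by (simp add: H_def column_labels_def initial_registers input_marks_def)
        then show ?thesis using tiles.input by simp
      next
        case a: 4
        have "tile i j = Tile {} {After} {After} {} (cell {} False)"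
          unfolding tile_def V using N(1) a 1 by (auto simp: H_def column_labels_def initial_registers input_marks_def)
        then show ?thesis using tiles.after by simp
      next
        case a: 5
        have "tile i j = Tile {} {After} {} {} (cell {} True)"
          unfolding tile_def V using N(1) a 1 by (auto simp: H_def column_labels_def initial_registers input_marks_def)
        then show ?thesis using tiles.first_end by simp
      qed
    next
      case 2
      let ?A = "{r. r < R \<and> w t r = i}" and ?B = "{r. r < R \<and> w (Suc t) r = i}"
      have "instr_reg (ins t) < R" unfolding ins_def using regs stp(1)[OF 2(2)] by simp
      then have upd: "update (P ! pc t) (z t) ?A (0 < i \<and> carry (ins t) (w t) (i - 1)) (i < N \<and> carry (ins t) (w t) i) ?B"
        using update_exec[of "ins t" "w t" "pc (Suc t)" "w (Suc t)" R i N] stp(2)[OF 2(2)] N(2)[of t] N(2)[of "Suc t"] 2(2) i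
        unfolding z_def ins_def by simp
      have AB: "?A \<subseteq> {..<R}" "?B \<subseteq> {..<R}" by auto
      have target: "target (P ! pc t) (z t) = pc (Suc t)"
        using stp(2)[OF 2(2)] unfolding z_def ins_def by (cases "P ! pc t") (auto split: if_splits)
      have marks: "input_marks n (int i, int j) = {}" unfolding input_marks_def 2 by simp
      have V: "V i (j - 1) = column_labels (pc t) (w t) N i" "V i j = column_labels (pc (Suc t)) (w (Suc t)) N i"
        unfolding V_def using 2 by simp_all
      have H: "H i' j = (if i' < N then row (pc t) (z t) (carry (ins t) (w t) i') else {})" for i'
        unfolding H_def using 2 by simp
      consider "i = 0" | "0 < i" "i < N" | "0 < i" "i = N" using i N(1) by linarith
      then show ?thesis
      proof cases
        case a: 1
        have "zero_ok (P ! pc t) (z t) ?A"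
          using \<open>instr_reg (ins t) < R\<close> a unfolding z_def ins_def by (cases "P ! pc t") auto
        from tiles.step_left[OF stp(1)[OF 2(2)] AB _ this] upd
        show ?thesis unfolding tile_def V H marks target column_labels_def using a 2 N(1) lt by simp
      next
        case a: 2
        from tiles.step_mid[OF stp(1)[OF 2(2)] AB] upd
        show ?thesis unfolding tile_def V H marks target column_labels_def using a 2 lt by simp
      next
        case a: 3
        from tiles.step_end[OF stp(1)[OF 2(2)] AB] upd
        show ?thesis unfolding tile_def V H marks target column_labels_def using a 2 lt by simp
      qed
    next
      case 3
      have marks: "input_marks n (int i, int j) = {}" unfolding input_marks_def 3 by simp
      have V: "V i (j - 1) = column_labels acc (w T) N i" "V i j = {}"
        unfolding V_def f'(3)[symmetric] using 3 by simp_all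
      have H: "H i' j = (if i' < N then {Final} else {})" for i'
        unfolding H_def using 3 by simp
      have A: "{r. r < R \<and> w T r = i} \<subseteq> {..<R}" by auto
      consider "i = 0" | "0 < i" "i < N" | "0 < i" "i = N" using i N(1) by linarith
      then show ?thesis
        unfolding tile_def V H marks column_labels_def using 3 N(1) lt
        by cases (use tiles.final_left[OF A] tiles.final_mid[OF A] tiles.final_end[OF A] in simp_all)
    qed
  qed
  define \<tau> where "\<tau> = (\<lambda>(a, b). if 0 \<le> a \<and> a \<le> int N \<and> 0 \<le> b \<and> b \<le> int (Suc T)
     then tile (nat a) (nat b) else blank)"
  have "tiling tiles (input_marks n) \<tau>"
    unfolding tiling_def
  proof (intro conjI allI)
    have "{g. \<tau> g \<noteq> blank} \<subseteq> {0..int N} \<times> {0..int (Suc T)}"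
      unfolding \<tau>_def by (auto split: if_splits)
    then show "finite {g. \<tau> g \<noteq> blank}" by (rule finite_subset) simp
    show "range \<tau> \<subseteq> insert blank tiles"
    proof
      fix t assume "t \<in> range \<tau>"
      then obtain a b where t: "t = \<tau> (a, b)" by auto
      show "t \<in> insert blank tiles" unfolding t \<tau>_def prod.case using tile[of "nat a" "nat b"] by (auto simp: nat_le_iff)
    qed
    show "marks (\<tau> g) = input_marks n g" for g
      using N(1) by (cases g) (auto simp: \<tau>_def tile_def input_marks_def)
    fix a b
    show "east (\<tau> (a, b)) = west (\<tau> (a + 1, b))"
    proof -
      consider "0 \<le> a" "a < int N" | "a = -1" | "a = int N" | "a < -1 \<or> a > int N" by linarith
      then show ?thesis
        by cases (auto simp: \<tau>_def tile_def nat_add_distrib H_def)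
    qed
    show "north (\<tau> (a, b)) = south (\<tau> (a, b + 1))"
    proof -
      consider "0 \<le> b" "b < int (Suc T)" | "b = -1" | "b = int (Suc T)" | "b < -1 \<or> b > int (Suc T)" by linarith
      then show ?thesis
        by cases (auto simp: \<tau>_def tile_def nat_add_distrib V_def)
    qed
  qed
  then show ?thesis by blast
qed

end

section \<open>Undecidability\<close>

lemma implements_run:
  assumes "implements a f [0] 1 2" "eval f [v 0] y" "P = code a 0 @ ys"
  shows "\<exists>v'. (step P)\<^sup>*\<^sup>* (0, v) (length (code a 0), v') \<and> v' 1 = y"
proof -
  obtain v' where "bigstep a v v'" "v' 1 = y"
    using implementsD[OF assms(1,2)] by auto
  then show ?thesis using steps_code[of a v v' P "[]" ys] assms(3) by auto
qed

section \<open>The instances and the rank of the module\<close>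

abbreviation instance_vector :: "nat \<Rightarrow> (int \<times> int) \<times> nat \<Rightarrow> 'r::ring_1" where
  "instance_vector n \<equiv> mark_vector TYPE(mark) TYPE(row_label) TYPE(column_label) (input_marks n)"

abbreviation mark_index :: "mark \<Rightarrow> nat" where
  "mark_index m \<equiv> to_nat (Inl m :: mark + row_label + column_label)"

definition instance_code :: "nat \<Rightarrow> nat \<Rightarrow> nat" where
  "instance_code one n = list_encode
     [prod_encode (int_encode 0, prod_encode (int_encode 0, prod_encode (mark_index Origin, one))),
      prod_encode (int_encode (int (Suc n)), prod_encode (int_encode 0, prod_encode (mark_index Input, one)))]"

lemma represents_instance: "represents enc (instance_code (enc 1) n) (instance_vector n :: _ \<Rightarrow> 'r::ring_1)"
proof -
  let ?es = "[((0, 0), mark_index Origin, 1), ((int (Suc n), 0), mark_index Input, 1)] :: ((int \<times> int) \<times> nat \<times> 'r) list"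
  have "(instance_vector n :: _ \<Rightarrow> 'r) p =
     (case map_of (map (\<lambda>(g, x, r). ((g, x), r)) ?es) p of None \<Rightarrow> 0 | Some r \<Rightarrow> r)" for p
    unfolding mark_vector_def input_marks_def by (cases p) (auto simp: image_Un)
  then show ?thesis
    unfolding represents_def instance_code_def
    by (intro exI[of _ ?es]) (auto simp: entry_code_def)
qed

lemma computable_instance_code: "computable 1 (\<lambda>xs. instance_code one (xs ! 0))"
proof -
  have "int_encode (int m) = m + m" for m
    by (simp add: int_encode_def sum_encode_def)
  \<comment> \<open>For two entries \<open>list_encode\<close> unfolds into pairing and successor,
    and computability can be read off term by term.\<close>
  then have "instance_code one n =
     Suc (prod_encode (prod_encode (int_encode 0, prod_encode (int_encode 0, prod_encode (mark_index Origin, one))),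
     Suc (prod_encode (prod_encode (Suc n + Suc n, prod_encode (int_encode 0, prod_encode (mark_index Input, one))), 0))))" for n
    unfolding instance_code_def list_encode.simps by (simp only:)
  then show ?thesis
    by (simp only:) (intro computable_Suc computable_prod_encode computable_add computable_const computable_nth; simp)
qed

lemma (in machine) instance_iff_tiling:
  "(instance_vector n :: _ \<Rightarrow> 'r::ring_1) \<in> subset_sum_set (tile_vector ` tiles)
     \<longleftrightarrow> (\<exists>\<tau>. tiling tiles (input_marks n) \<tau>)"
  by (rule subset_sum_iff_tiling)

lemma (in machine) vectors_in_free_mod:
  obtains k where "(tile_vector ` tiles :: ((int \<times> int) \<times> nat \<Rightarrow> 'r::ring_1) set) \<subseteq> free_mod k"
    "\<And>n. (instance_vector n :: _ \<Rightarrow> 'r) \<in> free_mod k"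
proof -
  \<comment> \<open>The rank is a bound on the indices of all labels in use. Both marks are added
    explicitly so that the instances, too, lie in the module.\<close>
  define L where "L = (\<Union>t\<in>tiles. out_labels t \<union> west_labels t \<union> south_labels t) \<union> {Inl Origin, Inl Input}"
  define k where "k = Suc (Max (to_nat ` L))"
  have "finite L" unfolding L_def using finite_tiles finite_labels by auto
  then have k: "to_nat l < k" if "l \<in> L" for l
    unfolding k_def using that by (simp add: less_Suc_eq_le)
  have "(tile_vector t :: _ \<Rightarrow> 'r) \<in> free_mod k" if "t \<in> tiles" for t
    by (rule tile_vector_in_free_mod) (use that k in \<open>auto simp: L_def\<close>)
  moreover have "(instance_vector n :: _ \<Rightarrow> 'r) \<in> free_mod k" for n
  proof -
    have "{p. (instance_vector n :: _ \<Rightarrow> 'r) p \<noteq> 0} \<subseteq> {((0, 0), mark_index Origin), ((int (Suc n), 0), mark_index Input)}"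
      unfolding mark_vector_def input_marks_def by (auto split: if_splits)
    from finite_subset[OF this] have "finite {p. (instance_vector n :: _ \<Rightarrow> 'r) p \<noteq> 0}" by simp
    moreover have "mark_index Origin < k" "mark_index Input < k" using k unfolding L_def by auto
    then have "(instance_vector n :: _ \<Rightarrow> 'r) (g, x) = 0" if "k \<le> x" for g x
      using that unfolding mark_vector_def input_marks_def by (auto split: if_splits)
    ultimately show ?thesis unfolding free_mod_def by simp
  qed
  ultimately show thesis using that[of k] by blast
qed

section \<open>The diagonal argument\<close>

theorem theorem4:
  fixes enc :: "'r::ring_1 \<Rightarrow> nat"
  assumes "effective_ring enc"
    and "(0::'r) \<noteq> 1"
  shows "\<exists>k (F :: ((int \<times> int) \<times> nat \<Rightarrow> 'r) set).
           finite F \<and> F \<subseteq> free_mod k \<and> (\<lambda>_. 0) \<notin> F \<and>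
           \<not> decidable_in_mod enc k (subset_sum_set F)"
proof -
  obtain u where u: "\<And>P v. (step P)\<^sup>*\<^sup>* (0, (\<lambda>_. 0)(0 := program_code P)) (length P, v) \<Longrightarrow>
     eval u [program_code P] (if v 1 = 0 then 0 else 1)"
    using universal by metis
  \<comment> \<open>Undoes the shift by one: the machine finds \<open>Suc n\<close> in register 0,
    the universal function expects \<open>n\<close>.\<close>
  have "computable 1 (\<lambda>xs. xs ! 0 - 1)" by (intro computable_pred computable_nth) simp
  then obtain p where p': "\<And>n. eval p [n] ([n] ! 0 - 1)"
    by (rule computable_1E) blast
  have p: "eval p [Suc n] n" for n
    using p'[of "Suc n"] by simp
  obtain a where a: "implements a (Comp u [p]) [0] 1 2"
    using implements_exists[of "[0]" 2 1 "Comp u [p]"] by auto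
  define m where "m = length (code a 0)"
  \<comment> \<open>The last instruction tests the output register: 0 leads to the accepting address
    \<open>m + 1\<close>, anything else to \<open>m + 2\<close>, which no tile accepts.\<close>
  define P where "P = code a 0 @ [DEC 1 (m + 2) (m + 1)]"
  define R where "R = Max (insert 0 (instr_reg ` set P)) + 1"
  have len: "length P = m + 1" unfolding P_def m_def by simp
  interpret machine P R "m + 1"
  proof
    show "instr_reg i < R" if "i \<in> set P" for i
      unfolding R_def using that by (simp add: less_Suc_eq_le)
  qed (auto simp: R_def len)
  let ?F = "tile_vector ` tiles :: ((int \<times> int) \<times> nat \<Rightarrow> 'r) set"
  obtain k where k: "?F \<subseteq> free_mod k" "\<And>n. (instance_vector n :: _ \<Rightarrow> 'r) \<in> free_mod k"
    using vectors_in_free_mod by metis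
  have run: "\<exists>v. (step P)\<^sup>*\<^sup>* (0, initial n) (if y = 0 then m + 1 else m + 2, v)" if y: "eval u [n] y" for n y
  proof -
    have "eval (Comp u [p]) [initial n 0] y"
      using y p[of n] by (intro eval_comp[where ys = "[n]"]) (simp_all add: initial_def)
    then obtain v where v: "(step P)\<^sup>*\<^sup>* (0, initial n) (m, v)" "v 1 = y"
      using implements_run[OF a _ P_def] unfolding m_def by blast
    have "step P (m, v) (exec (DEC 1 (m + 2) (m + 1)) v)"
      unfolding step_def P_def m_def by simp
    then have "step P (m, v) (if y = 0 then m + 1 else m + 2, snd (exec (DEC 1 (m + 2) (m + 1)) v))"
      using v(2) by (auto split: if_splits)
    with v(1) show ?thesis by (meson rtranclp.rtrancl_into_rtrancl)
  qed
  have "\<not> decidable_in_mod enc k (subset_sum_set ?F)"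
  proof
    assume "decidable_in_mod enc k (subset_sum_set ?F)"
    then obtain c where c: "\<And>code m. m \<in> free_mod k \<Longrightarrow> represents enc code m \<Longrightarrow>
       eval c [code] (if m \<in> subset_sum_set ?F then 1 else 0)"
      unfolding decidable_in_mod_def by blast
    obtain e where e: "\<And>n. eval e [n] (instance_code (enc 1) n)"
      using computable_instance_code[of "enc 1"] by (rule computable_1E) (simp, blast)
    let ?yes = "\<lambda>n. (instance_vector n :: _ \<Rightarrow> 'r) \<in> subset_sum_set ?F"
    have d: "eval (Comp c [e]) [n] (if ?yes n then 1 else 0)" for n
      using e c[OF k(2) represents_instance] by (intro eval_comp[where ys = "[instance_code (enc 1) n]"]) simp_all
    obtain b where b: "implements b (Comp c [e]) [0] 1 2"
      using implements_exists[of "[0]" 2 1 "Comp c [e]"] by auto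
    \<comment> \<open>\<open>Q\<close> is the supposed decision procedure as a machine, and it is
      asked about the instance given by its own code.\<close>
    define Q where "Q = code b 0"
    define n where "n = program_code Q"
    obtain v where v: "(step Q)\<^sup>*\<^sup>* (0, (\<lambda>_. 0)(0 := n)) (length Q, v)" "v 1 = (if ?yes n then 1 else 0)"
      using implements_run[OF b, of "(\<lambda>_. 0)(0 := n)" _ Q "[]"] d[of n] unfolding Q_def by auto
    have "eval u [n] (if ?yes n then 1 else 0)"
      using u[OF v(1)[unfolded n_def]] v(2) unfolding n_def[symmetric] by (simp split: if_splits)
    from run[OF this] obtain w where w: "(step P)\<^sup>*\<^sup>* (0, initial n) (if ?yes n then m + 2 else m + 1, w)"
      by (auto split: if_splits)
    have iff: "?yes n \<longleftrightarrow> (\<exists>\<tau>. tiling tiles (input_marks n) \<tau>)"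
      by (rule instance_iff_tiling)
    \<comment> \<open>The answer yes sends \<open>P\<close> to \<open>m + 2\<close>, which is
      impossible in the presence of a tiling; the answer no makes \<open>P\<close> accept, and then
      a tiling exists.\<close>
    show False
    proof (cases "?yes n")
      case True
      then obtain \<tau> where "tiling tiles (input_marks n) \<tau>" using iff by blast
      have "m + 2 < length P \<or> m + 2 = m + 1"
        by (rule tiling_sound[OF \<open>tiling tiles (input_marks n) \<tau>\<close>]) (use w True in simp)
      then show False using len by simp
    next
      case False
      then show False
        using tiling_complete[of n w] w iff by simp
    qed
  qed
  moreover have "(\<lambda>_. 0) \<notin> ?F"
    using tile_vector_neq_0 blank_notin_tiles by (metis (no_types, lifting) imageE)
  ultimately show ?thesis using k(1) finite_tiles by blast
qed

end
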